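(* Let $\mathcal A\in\mathbb R^{m\times n\times p}$, $\mathcal B\in\mathbb R^{m\times 1\times p}$, let $\mathcal K$ be a real third order tensor of size $q\times n\times p$, and let $\delta$ be the given bound. Let $(\tilde{\mathcal A},\tilde{\mathcal B},\mathcal X)$, with $\mathcal X\in\mathbb R^{n\times 1\times p}$, be a solution of the tensor regularized total least squares (TR-TLS) problem $$\min_{\tilde{\mathcal A},\tilde{\mathcal B},\mathcal X}\left\|(\mathcal A,\mathcal B)-(\tilde{\mathcal A},\tilde{\mathcal A}*\mathcal X)\right\|_F\quad\text{s.t.}\quad \tilde{\mathcal B}=\tilde{\mathcal A}*\mathcal X,\quad \|\mathcal K*\mathcal X\|_F\le\delta,$$ for which the inequality constraint holds with equality, $\|\mathcal K*\mathcal X\|_F=\delta$. Let $\mu\in\mathbb R$ be the corresponding Lagrange multiplier and let $\mathbf R=\mathcal B-\tilde{\mathcal A}*\mathcal X\in\mathbb R^{m\times 1\times p}$. Then $\mathcal X$ satisfies the tensor equation $$\Big[\mathcal A^\top*\mathcal A+\widetilde{\lambda_I}\otimes\mathcal I_{nnp}+\mathcal K^\top*\mathcal K*(\widetilde{\lambda_K}\otimes\mathcal I_{nnp})\Big]*\mathcal X=\mathcal A^\top*\mathcal B,$$ where the tubes $\widetilde{\lambda_I},\widetilde{\lambda_K}\in\mathbb R^{1\times1\times p}$ are given by $$\widetilde{\lambda_I}=\mu\,\mathcal X^\top*\mathcal K^\top*\mathcal K*\mathcal X-\mathbf R^\top*\mathbf R*\mathcal X^\top*\mathcal X-\mathbf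 R^\top*\mathcal B,\qquad \widetilde{\lambda_K}=\mu(\mathcal I_{11p}+\mathcal X^\top*\mathcal X),$$ and $\mu$ satisfies $$\mathcal B^\top*\mathbf R-\mathbf R^\top*\mathbf R=\mu\,\mathcal X^\top*\mathcal K^\top*\mathcal K*\mathcal X.$$ Moreover, $$\mathbf R=(\mathcal B-\mathcal A*\mathcal X)*(\mathcal I_{11p}+\mathcal X^\top*\mathcal X)^{-1}$$ and $$\widetilde{\lambda_K}*\mathcal X^\top*\mathcal K^\top*\mathcal K*\mathcal X=\mathcal B^\top*(\mathcal B-\mathcal A*\mathcal X)+\widetilde{\lambda_I}.$$
   Context: Notation. For $\mathcal A\in\mathbb R^{m\times n\times p}$ let $A^{(i)}\in\mathbb R^{m\times n}$ ($i=1,\dots,p$) be its frontal slices $\mathcal A[:,:,i]$. $\mathrm{bcirc}(\mathcal A)\in\mathbb R^{mp\times np}$ is the block circulant matrix whose first block column is $A^{(1)},A^{(2)},\dots,A^{(p)}$, i.e. whose $(i,j)$ block is $A^{(((i-j)\bmod p)+1)}$. It is block-diagonalized as $\mathrm{bcirc}(\mathcal A)=(F_p^{\rm H}\otimes I_m)\,\mathrm{diag}(A_1,\dots,A_p)\,(F_p\otimes I_n)$ with $A_i\in\mathbb C^{m\times n}$, where $F_p=\frac1{\sqrt p}(\omega^{(i-1)(j-1)})_{i,j=1}^p$, $\omega=e^{-2\pi \mathbf i/p}$. $\mathrm{unfold}(\mathcal B)$ stacks the frontal slices $B^{(1)},\dots,B^{(p)}$ vertically, and $\mathrm{fold}$ is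 its inverse. The T-product of $\mathcal A\in\mathbb R^{m\times n\times p}$ and $\mathcal B\in\mathbb R^{n\times s\times p}$ is $\mathcal A*\mathcal B=\mathrm{fold}(\mathrm{bcirc}(\mathcal A)\,\mathrm{unfold}(\mathcal B))\in\mathbb R^{m\times s\times p}$. The transpose $\mathcal A^\top\in\mathbb R^{n\times m\times p}$ has frontal slices $\mathcal A^\top[:,:,1]=\mathcal A[:,:,1]^\top$ and $\mathcal A^\top[:,:,i]=\mathcal A[:,:,p+2-i]^\top$ for $i=2,\dots,p$. The identity tensor $\mathcal I_{nnp}\in\mathbb R^{n\times n\times p}$ has first frontal slice $I_n$ and all other frontal slices zero ($\mathcal I_{11p}$ is the case $n=1$). The inverse of $\mathcal A\in\mathbb R^{n\times n\times p}$ is the tensor $\mathcal A^{-1}$ with $\mathcal A^{-1}*\mathcal A=\mathcal A*\mathcal A^{-1}=\mathcal I_{nnp}$. The Kronecker product (based on the T-product) of $\mathcal A\in\mathbb R^{m\times n\times p}$ and $\mathcal B\in\mathbb R^{t\times s\times p}$, with diagonal blocks $A_i\in\mathbb C^{m\times n}$, $B_i\in\mathbb C^{t\times s}$ in the block diagonalizations $\mathrm{bcirc}(\mathcal A)=(F_p^{\rm H}\otimes I_m)\,\mathrm{diag}(A_1,\dots,A_p)\,(F_p\otimes I_n)$ and $\mathrm{bcirc}(\mathcal B)=(F_p^{\rm H}\otimes I_t)\,\mathrm{diag}(B_1,\dots,B_p)\,(F_p\otimes I_s)$, is $\mathcal A\otimes\mathcal B=\mathrm{bcirc}^{-1}\big((F_p^{\rm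 H}\otimes I_{mt})\,\mathrm{diag}(A_1\otimes B_1,\dots,A_p\otimes B_p)\,(F_p\otimes I_{ns})\big)\in\mathbb R^{mt\times ns\times p}$. The Frobenius norm is $\|\mathcal X\|_F=\sqrt{\sum_{i,j,k}x_{ijk}^2}$. $(\mathcal A,\mathcal B)$ denotes concatenation along the second mode. A tube is an element of $\mathbb R^{1\times1\times p}$. Lagrange multiplier: the Lagrangian of the TR-TLS problem is $\hat{\mathcal L}(\tilde{\mathcal A},\mathcal X,\mu)=\|(\mathcal A,\mathcal B)-(\tilde{\mathcal A},\tilde{\mathcal A}*\mathcal X)\|_F^2+\mu(\|\mathcal K*\mathcal X\|_F^2-\delta^2)$; $\mu$ being the corresponding Lagrange multiplier means that the partial derivatives of $\hat{\mathcal L}$ with respect to $\tilde{\mathcal A}$ and $\mathcal X$ vanish at the solution $(\tilde{\mathcal A},\mathcal X)$ with this $\mu$. *)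

theory Defs
  imports "Jordan_Normal_Form.Schur_Decomposition"
begin

text \<open>
  A third order tensor is the list of its frontal slices, so \<open>T ! k $$ (i, j)\<close> is the entry
  with indices \<open>(i + 1, j + 1, k + 1)\<close> in the usual one-based notation.
  All operations are meaningful on tensors in some \<open>tensor_carrier m n p\<close> with \<open>p > 0\<close>.
\<close>

type_synonym 'a tensor = "'a mat list"

definition tensor_carrier :: "nat \<Rightarrow> nat \<Rightarrow> nat \<Rightarrow> 'a tensor set" where
  "tensor_carrier m n p = {T. length T = p \<and> set T \<subseteq> carrier_mat m n}"

definition t_rows :: "'a tensor \<Rightarrow> nat" where
  "t_rows T = dim_row (T ! 0)"

definition t_cols :: "'a tensor \<Rightarrow> nat" where
  "t_cols T = dim_col (T ! 0)"

definition t_add :: "'a :: plus tensor \<Rightarrow> 'a tensor \<Rightarrow> 'a tensor" (infixl "+\<^sub>T" 65) where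
  "A +\<^sub>T B = map2 (+) A B"

definition t_minus :: "'a :: minus tensor \<Rightarrow> 'a tensor \<Rightarrow> 'a tensor" (infixl "-\<^sub>T" 65) where
  "A -\<^sub>T B = map2 (-) A B"

definition t_smult :: "'a :: times \<Rightarrow> 'a tensor \<Rightarrow> 'a tensor" (infixl "\<cdot>\<^sub>T" 70) where
  "c \<cdot>\<^sub>T A = map (\<lambda>M. c \<cdot>\<^sub>m M) A"


text \<open>
  For zero-based block indices \<open>i, j < p\<close>, block \<open>(i, j)\<close> of \<open>bcirc A\<close> is the slice with index
  \<open>(i - j) mod p\<close>; the summand \<open>length A\<close> only avoids truncated subtraction.
\<close>

definition bcirc :: "'a tensor \<Rightarrow> 'a mat" where
  "bcirc A = mat (t_rows A * length A) (t_cols A * length A)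
     (\<lambda>(r, c). A ! ((r div t_rows A + length A - c div t_cols A) mod length A)
                 $$ (r mod t_rows A, c mod t_cols A))"

definition t_unfold :: "'a tensor \<Rightarrow> 'a mat" where
  "t_unfold B = mat (t_rows B * length B) (t_cols B)
     (\<lambda>(r, c). B ! (r div t_rows B) $$ (r mod t_rows B, c))"

definition t_fold :: "nat \<Rightarrow> 'a mat \<Rightarrow> 'a tensor" where
  "t_fold p M = map (\<lambda>k. mat (dim_row M div p) (dim_col M)
     (\<lambda>(i, j). M $$ (k * (dim_row M div p) + i, j))) [0..<p]"

definition t_prod :: "'a :: semiring_0 tensor \<Rightarrow> 'a tensor \<Rightarrow> 'a tensor" (infixl "*\<^sub>T" 70) where
  "A *\<^sub>T B = t_fold (length A) (bcirc A * t_unfold B)"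

definition t_transpose :: "'a tensor \<Rightarrow> 'a tensor" ("(_\<^sup>\<top>)" [1000] 999) where
  "A\<^sup>\<top> = map (\<lambda>k. if k = 0 then transpose_mat (A ! 0) else transpose_mat (A ! (length A - k)))
            [0..<length A]"

definition t_id :: "nat \<Rightarrow> nat \<Rightarrow> 'a :: zero_neq_one tensor" where
  "t_id n p = map (\<lambda>k. if k = 0 then 1\<^sub>m n else 0\<^sub>m n n) [0..<p]"

definition is_t_inverse :: "'a :: semiring_1 tensor \<Rightarrow> 'a tensor \<Rightarrow> bool" where
  "is_t_inverse A C \<longleftrightarrow>
     C \<in> tensor_carrier (t_rows A) (t_rows A) (length A) \<and>
     C *\<^sub>T A = t_id (t_rows A) (length A) \<and> A *\<^sub>T C = t_id (t_rows A) (length A)"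

definition t_invertible :: "'a :: semiring_1 tensor \<Rightarrow> bool" where
  "t_invertible A \<longleftrightarrow>
     A \<in> tensor_carrier (t_rows A) (t_rows A) (length A) \<and> (\<exists>C. is_t_inverse A C)"

definition t_inverse :: "'a :: semiring_1 tensor \<Rightarrow> 'a tensor" where
  "t_inverse A = (THE C. is_t_inverse A C)"

definition t_frob :: "real tensor \<Rightarrow> real" where
  "t_frob X = sqrt (\<Sum>k<length X. \<Sum>i<t_rows X. \<Sum>j<t_cols X. (X ! k $$ (i, j))\<^sup>2)"

definition t_concat :: "'a :: zero tensor \<Rightarrow> 'a tensor \<Rightarrow> 'a tensor" where
  "t_concat A B = map2 (\<lambda>M N. four_block_mat M N (0\<^sub>m 0 (dim_col M)) (0\<^sub>m 0 (dim_col N))) A B"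


definition mat_kron :: "'a :: times mat \<Rightarrow> 'a mat \<Rightarrow> 'a mat" where
  "mat_kron A B = mat (dim_row A * dim_row B) (dim_col A * dim_col B)
     (\<lambda>(i, j). A $$ (i div dim_row B, j div dim_col B) * B $$ (i mod dim_row B, j mod dim_col B))"

definition dft_mat :: "nat \<Rightarrow> complex mat" where
  "dft_mat p = mat p p (\<lambda>(i, j). exp (- (2 * pi * \<i>) / of_nat p) ^ (i * j) / sqrt (real p))"

text \<open>
  \<open>block_fourier m n Ds\<close> is \<open>(F\<^sup>H \<otimes> I\<^sub>m) diag(D\<^sub>1, \<dots>, D\<^sub>p) (F \<otimes> I\<^sub>n)\<close>.
\<close>

definition block_fourier :: "nat \<Rightarrow> nat \<Rightarrow> complex mat list \<Rightarrow> complex mat" where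
  "block_fourier m n Ds =
     mat_kron (mat_adjoint (dft_mat (length Ds))) (1\<^sub>m m) * diag_block_mat Ds *
     mat_kron (dft_mat (length Ds)) (1\<^sub>m n)"

definition diag_blocks :: "real tensor \<Rightarrow> complex mat list" where
  "diag_blocks A = (THE Ds. Ds \<in> tensor_carrier (t_rows A) (t_cols A) (length A) \<and>
     map_mat complex_of_real (bcirc A) = block_fourier (t_rows A) (t_cols A) Ds)"

definition bcirc_inv :: "nat \<Rightarrow> complex mat \<Rightarrow> real tensor" where
  "bcirc_inv p M = (THE T. T \<in> tensor_carrier (dim_row M div p) (dim_col M div p) p \<and>
     map_mat complex_of_real (bcirc T) = M)"

definition t_kron :: "real tensor \<Rightarrow> real tensor \<Rightarrow> real tensor" (infixl "\<otimes>\<^sub>T" 70) where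
  "A \<otimes>\<^sub>T B = bcirc_inv (length A)
     (block_fourier (t_rows A * t_rows B) (t_cols A * t_cols B)
        (map2 mat_kron (diag_blocks A) (diag_blocks B)))"


definition tr_tls_feasible ::
  "real tensor \<Rightarrow> real tensor \<Rightarrow> real tensor \<Rightarrow> real \<Rightarrow>
   real tensor \<Rightarrow> real tensor \<Rightarrow> real tensor \<Rightarrow> bool" where
  "tr_tls_feasible A B K \<delta> At Bt X \<longleftrightarrow>
     At \<in> tensor_carrier (t_rows A) (t_cols A) (length A) \<and>
     Bt \<in> tensor_carrier (t_rows B) (t_cols B) (length A) \<and>
     X \<in> tensor_carrier (t_cols A) (t_cols B) (length A) \<and>
     Bt = At *\<^sub>T X \<and> t_frob (K *\<^sub>T X) \<le> \<delta>"

definition tr_tls_objective ::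
  "real tensor \<Rightarrow> real tensor \<Rightarrow> real tensor \<Rightarrow> real tensor \<Rightarrow> real" where
  "tr_tls_objective A B At X = t_frob (t_concat A B -\<^sub>T t_concat At (At *\<^sub>T X))"

definition tr_tls_solution ::
  "real tensor \<Rightarrow> real tensor \<Rightarrow> real tensor \<Rightarrow> real \<Rightarrow>
   real tensor \<Rightarrow> real tensor \<Rightarrow> real tensor \<Rightarrow> bool" where
  "tr_tls_solution A B K \<delta> At Bt X \<longleftrightarrow>
     tr_tls_feasible A B K \<delta> At Bt X \<and>
     (\<forall>At' Bt' X'. tr_tls_feasible A B K \<delta> At' Bt' X' \<longrightarrow>
        tr_tls_objective A B At X \<le> tr_tls_objective A B At' X')"

definition tr_tls_lagrangian ::
  "real tensor \<Rightarrow> real tensor \<Rightarrow> real tensor \<Rightarrow> real \<Rightarrow>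
   real tensor \<Rightarrow> real tensor \<Rightarrow> real \<Rightarrow> real" where
  "tr_tls_lagrangian A B K \<delta> At X \<mu> =
     (t_frob (t_concat A B -\<^sub>T t_concat At (At *\<^sub>T X)))\<^sup>2 + \<mu> * ((t_frob (K *\<^sub>T X))\<^sup>2 - \<delta>\<^sup>2)"

definition t_update :: "'a tensor \<Rightarrow> nat \<Rightarrow> nat \<Rightarrow> nat \<Rightarrow> 'a \<Rightarrow> 'a tensor" where
  "t_update T i j k t =
     T[k := mat (t_rows T) (t_cols T) (\<lambda>(i', j'). if i' = i \<and> j' = j then t else T ! k $$ (i', j'))]"

text \<open>
  The partial derivatives of a function \<open>f\<close> of a tensor with respect to all entries exist at \<open>T\<close>
  and are zero.
\<close>

definition partials_vanish :: "(real tensor \<Rightarrow> real) \<Rightarrow> real tensor \<Rightarrow> bool" where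
  "partials_vanish f T \<longleftrightarrow>
     (\<forall>i<t_rows T. \<forall>j<t_cols T. \<forall>k<length T.
        ((\<lambda>t. f (t_update T i j k t)) has_real_derivative 0) (at (T ! k $$ (i, j))))"

definition is_lagrange_multiplier ::
  "real tensor \<Rightarrow> real tensor \<Rightarrow> real tensor \<Rightarrow> real \<Rightarrow>
   real tensor \<Rightarrow> real tensor \<Rightarrow> real \<Rightarrow> bool" where
  "is_lagrange_multiplier A B K \<delta> At X \<mu> \<longleftrightarrow>
     partials_vanish (\<lambda>At'. tr_tls_lagrangian A B K \<delta> At' X \<mu>) At \<and>
     partials_vanish (\<lambda>X'. tr_tls_lagrangian A B K \<delta> At X' \<mu>) X"

end

(*
  Setting the partial derivatives of the Lagrangian to zero gives, by the adjointness relations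
  <Y, A * Z> = <A^T * Y, Z> and <Y, Z * X> = <Y * X^T, Z> for the Frobenius inner product,
    At = A + R * X^T   and   At^T * R = mu K^T * K * X.
  Everything else is algebra with the T-product. Multiplying the second equation by X^T and using
  At * X = B - R gives the equation for mu, which also shows that B^T * R is a symmetric tube.
  With s = I + X^T * X, multiplying the first equation by X gives R * s = B - A * X, whence
  lambda_I = - R^T * R * s; the main equation is At^T * R = mu K^T * K * X multiplied by s.
  The tube s is invertible because <c, s * c> = |c|^2 + |X * c|^2. Finally, Fourier inversion
  identifies lambda \<otimes> I with the tensor whose slices are lambda_k I, and this tensor acts on
  X as multiplication by the tube lambda from the right.
*)
theory Submission
  imports Defs
begin

subsection \<open>Preliminaries on sums, block matrices and quadratics\<close>

text \<open>Dimensions are not part of the type of a tensor, and the T-product is defined by div/mod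
  arithmetic on block matrices. Reading slices through \<open>t_entry\<close> with an integer index
  makes entries periodic in that index, so the laws of the T-product come down to shifting or
  reflecting a sum over residues, and equality of tensors is checked entrywise. Inverse, diagonal
  blocks and \<open>bcirc_inv\<close> are definite descriptions, so each needs a uniqueness
  argument: the monoid one, Fourier inversion, and injectivity of \<open>bcirc\<close>. No calculus
  beyond one variable occurs: along a single entry the Lagrangian is a quadratic polynomial, so a
  vanishing derivative kills its linear coefficient. The symmetry of B^T * R matters because
  lambda_I is built from R^T * B, whereas stationarity produces B^T * R. Once the two are
  identified, the copies of B^T * R inside lambda_I cancel and leave -R^T * R * (I + X^T *
  X).\<close>

lemma sum_div_mod:
  fixes f :: "nat \<Rightarrow> nat \<Rightarrow> 'a :: comm_monoid_add"
  shows "(\<Sum>c<n * p. f (c div n) (c mod n)) = (\<Sum>l<p. \<Sum>s<n. f l s)"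
proof -
  have "(\<Sum>c<p * n. f (c div n) (c mod n)) = (\<Sum>l<p. \<Sum>c\<in>{l * n..<l * n + n}. f (c div n) (c mod n))"
    by (rule sum.nat_group[symmetric])
  also have "\<dots> = (\<Sum>l<p. \<Sum>s<n. f l s)"
  proof (rule sum.cong[OF refl])
    fix l
    have "(\<Sum>c\<in>{l * n..<l * n + n}. f (c div n) (c mod n)) = (\<Sum>s = 0..<n. f ((s + l * n) div n) ((s + l * n) mod n))"
      using sum.shift_bounds_nat_ivl[of "\<lambda>c. f (c div n) (c mod n)" 0 "l * n" n]
      by (simp add: add.commute)
    also have "\<dots> = (\<Sum>s<n. f l s)"
      by (rule sum.cong) auto
    finally show "(\<Sum>c\<in>{l * n..<l * n + n}. f (c div n) (c mod n)) = (\<Sum>s<n. f l s)" .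
  qed
  finally show ?thesis by (simp add: mult.commute)
qed

text \<open>An injective self-map of the p residues is a permutation, and periodicity of
  \<open>f\<close> makes the reduction mod p invisible. Shifts and reflections of a convolution
  index are the two instances needed.\<close>

lemma sum_mod_reindex:
  fixes f :: "int \<Rightarrow> 'a :: comm_monoid_add"
  assumes per: "\<And>x. f (x mod int p) = f x"
    and inj: "inj_on (\<lambda>l. g (int l) mod int p) {..<p}"
  shows "(\<Sum>l<p. f (g (int l))) = (\<Sum>l<p. f (int l))"
proof (cases "p = 0")
  case False
  have inj': "inj_on (\<lambda>l. nat (g (int l) mod int p)) {..<p}"
    using inj False by (auto simp: inj_on_def eq_nat_nat_iff)
  have sub: "(\<lambda>l. nat (g (int l) mod int p)) ` {..<p} \<subseteq> {..<p}"
    using False by (auto simp: nat_less_iff)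
  have img: "(\<lambda>l. nat (g (int l) mod int p)) ` {..<p} = {..<p}"
    by (rule endo_inj_surj[OF _ sub inj']) simp
  have "(\<Sum>l<p. f (int l)) = (\<Sum>l<p. f (int (nat (g (int l) mod int p))))"
    by (subst img[symmetric], subst sum.reindex[OF inj']) simp
  also have "\<dots> = (\<Sum>l<p. f (g (int l)))"
    using False by (simp add: per)
  finally show ?thesis by simp
qed simp

lemma sum_mod_shift:
  fixes f :: "int \<Rightarrow> 'a :: comm_monoid_add"
  assumes per: "\<And>x. f (x mod int p) = f x"
  shows "(\<Sum>l<p. f (int l - c)) = (\<Sum>l<p. f (int l))"
proof (rule sum_mod_reindex[where f = f and g = "\<lambda>x. x - c", OF per])
  have "l = l'" if "l < p" "l' < p" "(int l - c) mod int p = (int l' - c) mod int p" for l l'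
  proof -
    have "int l mod int p = int l' mod int p"
      using mod_add_cong[OF that(3) refl, of c] by simp
    then show ?thesis using that by simp
  qed
  then show "inj_on (\<lambda>l. (int l - c) mod int p) {..<p}" by (auto simp: inj_on_def)
qed

lemma sum_mod_reflect:
  fixes f :: "int \<Rightarrow> 'a :: comm_monoid_add"
  assumes per: "\<And>x. f (x mod int p) = f x"
  shows "(\<Sum>l<p. f (c - int l)) = (\<Sum>l<p. f (int l))"
proof (rule sum_mod_reindex[where f = f and g = "\<lambda>x. c - x", OF per])
  have "l = l'" if "l < p" "l' < p" "(c - int l) mod int p = (c - int l') mod int p" for l l'
  proof -
    have "int l mod int p = int l' mod int p"
      using mod_diff_cong[OF refl[of "c mod int p"] that(3)] by simp
    then show ?thesis using that by simp
  qed
  then show "inj_on (\<lambda>l. (c - int l) mod int p) {..<p}" by (auto simp: inj_on_def)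
qed

lemma sum_swap3:
  fixes F :: "'b \<Rightarrow> 'c \<Rightarrow> 'd \<Rightarrow> 'a :: comm_monoid_add"
  shows "(\<Sum>x\<in>A. \<Sum>y\<in>B. \<Sum>z\<in>C. F x y z) = (\<Sum>z\<in>C. \<Sum>y\<in>B. \<Sum>x\<in>A. F x y z)"
  by (rule trans[OF sum.cong[OF refl sum.swap] trans[OF sum.swap sum.cong[OF refl sum.swap]]])

lemma sum_lessThan_add:
  fixes f :: "nat \<Rightarrow> 'a :: comm_monoid_add"
  shows "(\<Sum>j<n + s. f j) = (\<Sum>j<n. f j) + (\<Sum>j<s. f (n + j))"
  by (induction s) (simp_all add: add.assoc)

lemma block_index:
  fixes k m i p :: nat
  assumes "k < p" "i < m" shows "k * m + i < m * p" "(k * m + i) div m = k" "(k * m + i) mod m = i"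
proof -
  have "k * m + i < Suc k * m" using assms by simp
  also have "\<dots> \<le> p * m" using assms by (intro mult_le_mono1) simp
  finally show "k * m + i < m * p" by (simp add: mult.commute)
qed (use assms in auto)

lemma mult_mat_index_sum:
  fixes A B :: "'a :: semiring_0 mat"
  assumes "A \<in> carrier_mat m n" "B \<in> carrier_mat n s" "i < m" "j < s"
  shows "(A * B) $$ (i, j) = (\<Sum>k<n. A $$ (i, k) * B $$ (k, j))"
  using assms by (auto simp: scalar_prod_def lessThan_atLeast0 intro!: sum.cong)

lemma diag_block_mat_carrier:
  assumes "set Ds \<subseteq> carrier_mat m n"
  shows "diag_block_mat Ds \<in> carrier_mat (m * length Ds) (n * length Ds)"
  using assms
proof (induction Ds)
  case (Cons D Ds)
  then have "D \<in> carrier_mat m n" "diag_block_mat Ds \<in> carrier_mat (m * length Ds) (n * length Ds)" by auto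
  then show ?case by (auto simp: Let_def)
qed simp

text \<open>All blocks have the same size, so div locates the block. The induction peels off the
  leading block: subtracting \<open>m\<close> lowers \<open>r div m\<close> by one and keeps
  \<open>r mod m\<close>.\<close>

lemma diag_block_mat_index:
  assumes "set Ds \<subseteq> carrier_mat m n" "r < m * length Ds" "c < n * length Ds"
  shows "diag_block_mat Ds $$ (r, c) =
    (if r div m = c div n then Ds ! (r div m) $$ (r mod m, c mod n) else 0)"
  using assms
proof (induction Ds arbitrary: r c)
  case (Cons D Ds)
  have D: "D \<in> carrier_mat m n" and Ds: "set Ds \<subseteq> carrier_mat m n" using Cons.prems by auto
  note B = diag_block_mat_carrier[OF Ds]
  have pos: "m > 0" "n > 0" using Cons.prems by (auto intro: Nat.gr0I)
  have r: "r div m = Suc ((r - m) div m)" "r mod m = (r - m) mod m" "r - m < m * length Ds" if "\<not> r < m"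
    using that pos Cons.prems by (auto simp: le_div_geq le_mod_geq)
  have c: "c div n = Suc ((c - n) div n)" "c mod n = (c - n) mod n" "c - n < n * length Ds" if "\<not> c < n"
    using that pos Cons.prems by (auto simp: le_div_geq le_mod_geq)
  have rc: "r < m + m * length Ds" "c < n + n * length Ds" using Cons.prems by auto
  show ?case
    using Cons.IH[OF Ds, of "r - m" "c - n"] r c carrier_matD[OF D] carrier_matD[OF B] rc
    by (cases "r < m"; cases "c < n") (simp_all add: Let_def)
qed simp

text \<open>Expanded at \<open>t0\<close>, the linear coefficient is the derivative there. This is
  the only link between \<open>has_real_derivative\<close> and the tensor algebra.\<close>

lemma quadratic_stationary:
  fixes f :: "real \<Rightarrow> real"
  assumes "(f has_real_derivative 0) (at t0)"
    and "\<And>t. f t = a + (t - t0) * b + (t - t0)\<^sup>2 * c"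
  shows "b = 0"
proof -
  have "((\<lambda>t. a + (t - t0) * b + (t - t0)\<^sup>2 * c) has_real_derivative b) (at t0)"
    by (auto intro!: derivative_eq_intros)
  moreover have "f = (\<lambda>t. a + (t - t0) * b + (t - t0)\<^sup>2 * c)" using assms(2) by auto
  ultimately show ?thesis using assms(1) DERIV_unique by blast
qed

subsection \<open>Algebra of the T-product\<close>

text \<open>
  Reading the slice index modulo the number of slices turns \<open>*\<^sub>T\<close> into a cyclic convolution and
  the transpose into a reflection, without case distinctions.
\<close>

definition t_entry :: "'a tensor \<Rightarrow> int \<Rightarrow> nat \<Rightarrow> nat \<Rightarrow> 'a" where
  "t_entry T k i j = T ! nat (k mod int (length T)) $$ (i, j)"

lemma t_entry_nth: "k < length T \<Longrightarrow> t_entry T (int k) i j = T ! k $$ (i, j)"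
  by (simp add: t_entry_def)

lemma tensor_carrierD:
  assumes "T \<in> tensor_carrier m n p"
  shows "length T = p" "k < p \<Longrightarrow> T ! k \<in> carrier_mat m n"
  using assms by (auto simp: tensor_carrier_def)

lemma tensor_carrierI:
  assumes "length T = p" "\<And>k. k < p \<Longrightarrow> T ! k \<in> carrier_mat m n"
  shows "T \<in> tensor_carrier m n p"
  using assms by (auto simp: tensor_carrier_def set_conv_nth)

lemma t_entry_mod:
  "T \<in> tensor_carrier m n p \<Longrightarrow> t_entry T (k mod int p) i j = t_entry T k i j"
  by (simp add: t_entry_def tensor_carrierD)

definition t_inner :: "real tensor \<Rightarrow> real tensor \<Rightarrow> real" where
  "t_inner Y Z = (\<Sum>k<length Y. \<Sum>i<t_rows Y. \<Sum>j<t_cols Y. Y ! k $$ (i, j) * Z ! k $$ (i, j))"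

lemma t_frob_square: "(t_frob Y)\<^sup>2 = t_inner Y Y"
  unfolding t_frob_def t_inner_def
  by (subst real_sqrt_pow2) (auto intro!: sum_nonneg simp: power2_eq_square)

lemma t_inner_self_nonneg: "0 \<le> t_inner Y Y"
  by (metis t_frob_square zero_le_power2)

context
  fixes p :: nat
  assumes p_pos: "0 < p"
begin

text \<open>\<open>t_rows\<close> and \<open>t_cols\<close> inspect slice 0, so the carrier
  determines them only when there is at least one slice; hence the fixed assumption 0 < p.\<close>

lemma tensor_dims:
  assumes "T \<in> tensor_carrier m n p"
  shows "t_rows T = m" "t_cols T = n" "length T = p"
  using tensor_carrierD(2)[OF assms, of 0] tensor_carrierD(1)[OF assms] p_pos
  by (auto simp: t_rows_def t_cols_def)

lemma slice_less: "nat (k mod int p) < p"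
  using p_pos by (simp add: nat_less_iff)

lemma tensor_slice:
  assumes "T \<in> tensor_carrier m n p"
  shows "T ! nat (k mod int p) \<in> carrier_mat m n"
  using tensor_carrierD[OF assms] slice_less by blast

lemma tensor_eqI:
  assumes S: "S \<in> tensor_carrier m n p" and T: "T \<in> tensor_carrier m n p"
    and eq: "\<And>k i j. i < m \<Longrightarrow> j < n \<Longrightarrow> t_entry S k i j = t_entry T k i j"
  shows "S = T"
proof (rule nth_equalityI)
  show "length S = length T" using S T by (simp add: tensor_carrierD)
  fix k assume "k < length S"
  then have k: "k < p" using S by (simp add: tensor_carrierD)
  show "S ! k = T ! k"
  proof (rule eq_matI)
    fix i j assume "i < dim_row (T ! k)" "j < dim_col (T ! k)"
    then have "i < m" "j < n" using tensor_carrierD(2)[OF T k] by auto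
    then show "S ! k $$ (i, j) = T ! k $$ (i, j)"
      using eq[of i j "int k"] k S T by (simp add: t_entry_nth tensor_carrierD)
  qed (use tensor_carrierD(2)[OF T k] tensor_carrierD(2)[OF S k] in auto)
qed

section \<open>Entries of the tensor operations\<close>

lemma t_add_carrier:
  assumes "S \<in> tensor_carrier m n p" "T \<in> tensor_carrier m n p"
  shows "S +\<^sub>T T \<in> tensor_carrier m n p"
  using assms by (auto intro!: tensor_carrierI simp: t_add_def tensor_carrierD)

lemma t_entry_add:
  assumes "S \<in> tensor_carrier m n p" "T \<in> tensor_carrier m n p" "i < m" "j < n"
  shows "t_entry (S +\<^sub>T T) k i j = t_entry S k i j + t_entry T k i j"
  using assms carrier_matD[OF tensor_slice[OF assms(2), of k]] slice_less[of k]
  by (auto simp: t_entry_def t_add_def tensor_carrierD)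

lemma t_minus_carrier:
  assumes "S \<in> tensor_carrier m n p" "T \<in> tensor_carrier m n p"
  shows "S -\<^sub>T T \<in> tensor_carrier m n p"
  using assms by (auto intro!: tensor_carrierI minus_carrier_mat simp: t_minus_def tensor_carrierD)

lemma t_entry_minus:
  assumes "S \<in> tensor_carrier m n p" "T \<in> tensor_carrier m n p" "i < m" "j < n"
  shows "t_entry (S -\<^sub>T T) k i j = t_entry S k i j - t_entry T k i j"
  using assms carrier_matD[OF tensor_slice[OF assms(2), of k]] slice_less[of k]
  by (auto simp: t_entry_def t_minus_def tensor_carrierD)

lemma t_smult_carrier:
  assumes "T \<in> tensor_carrier m n p"
  shows "c \<cdot>\<^sub>T T \<in> tensor_carrier m n p"
  using assms by (auto intro!: tensor_carrierI simp: t_smult_def tensor_carrierD)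

lemma t_entry_smult:
  assumes "T \<in> tensor_carrier m n p" "i < m" "j < n"
  shows "t_entry (c \<cdot>\<^sub>T T) k i j = c * t_entry T k i j"
  using assms carrier_matD[OF tensor_slice[OF assms(1), of k]] slice_less[of k]
  by (auto simp: t_entry_def t_smult_def tensor_carrierD)

lemma t_id_carrier: "t_id n p \<in> tensor_carrier n n p"
  by (auto intro!: tensor_carrierI simp: t_id_def)

lemma t_entry_id:
  assumes "i < n" "j < n"
  shows "t_entry (t_id n p) k i j = (if int p dvd k \<and> i = j then 1 else 0)"
proof -
  have "k mod int p < int p" "0 \<le> k mod int p" using p_pos by auto
  then have "nat (k mod int p) = 0 \<longleftrightarrow> int p dvd k" by (auto simp: dvd_eq_mod_eq_0)
  then show ?thesis
    using assms slice_less[of k] by (auto simp: t_entry_def t_id_def)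
qed

lemma t_transpose_carrier:
  assumes "T \<in> tensor_carrier m n p"
  shows "T\<^sup>\<top> \<in> tensor_carrier n m p"
proof (rule tensor_carrierI)
  show "length (T\<^sup>\<top>) = p" using assms by (simp add: t_transpose_def tensor_carrierD)
  fix k assume "k < p"
  then show "T\<^sup>\<top> ! k \<in> carrier_mat n m"
    using tensor_carrierD[OF assms] by (auto simp: t_transpose_def)
qed

lemma t_entry_transpose:
  assumes T: "T \<in> tensor_carrier m n p" and "i < n" "j < m"
  shows "t_entry (T\<^sup>\<top>) k i j = t_entry T (- k) j i"
proof -
  let ?k = "nat (k mod int p)"
  have k: "?k < p" by (rule slice_less)
  have len: "length T = p" using T by (simp add: tensor_carrierD)
  \<comment> \<open>The case distinction in the definition of the transpose is exactly the one for
    the remainder of -k, so both cases merge into a reflection.\<close>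
  have neg: "nat (- k mod int p) = (if ?k = 0 then 0 else p - ?k)"
    using p_pos pos_mod_sign[of "int p" k] by (auto simp: zmod_zminus1_eq_if nat_diff_distrib simp del: pos_mod_sign)
  have "t_entry (T\<^sup>\<top>) k i j = transpose_mat (T ! nat (- k mod int p)) $$ (i, j)"
    unfolding neg using k by (simp add: t_entry_def t_transpose_def len)
  also have "\<dots> = T ! nat (- k mod int p) $$ (j, i)"
    using tensor_slice[OF T, of "- k"] assms(2,3) by auto
  finally show ?thesis by (simp add: t_entry_def len)
qed

lemma bcirc_carrier:
  "T \<in> tensor_carrier m n p \<Longrightarrow> bcirc T \<in> carrier_mat (m * p) (n * p)"
  by (simp add: bcirc_def tensor_dims)

lemma bcirc_index:
  assumes T: "T \<in> tensor_carrier m n p" and "r < m * p" "c < n * p"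
  shows "bcirc T $$ (r, c) = t_entry T (int (r div m) - int (c div n)) (r mod m) (c mod n)"
proof -
  have "c div n < p" using assms(3) by (simp add: less_mult_imp_div_less mult.commute)
  then have "int (r div m + p - c div n) = int (r div m) - int (c div n) + int p"
    by (simp add: of_nat_diff)
  then have "nat ((int (r div m) - int (c div n)) mod int p) = (r div m + p - c div n) mod p"
    by (metis mod_add_self2 nat_int zmod_int)
  then show ?thesis
    using assms by (simp add: bcirc_def tensor_dims[OF T] t_entry_def)
qed

lemma t_prod_carrier:
  assumes A: "A \<in> tensor_carrier m n p" and B: "B \<in> tensor_carrier n s p"
  shows "A *\<^sub>T B \<in> tensor_carrier m s p"
  using p_pos by (auto intro!: tensor_carrierI
      simp: t_prod_def t_fold_def t_unfold_def bcirc_def tensor_dims[OF A] tensor_dims[OF B])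

text \<open>Row k*m + i of the block circulant meets column j of the unfolding; splitting the
  summation index as l*n + h turns the product into a cyclic convolution of matrix products. For an
  arbitrary integer k the row block is its residue, which \<open>per\<close> replaces by k
  again.\<close>

lemma t_entry_prod:
  fixes A B :: "'a :: semiring_0 tensor"
  assumes A: "A \<in> tensor_carrier m n p" and B: "B \<in> tensor_carrier n s p"
    and i: "i < m" and j: "j < s"
  shows "t_entry (A *\<^sub>T B) k i j =
    (\<Sum>l<p. \<Sum>h<n. t_entry A (k - int l) i h * t_entry B (int l) h j)"
proof -
  let ?k = "nat (k mod int p)"
  have k: "?k < p" by (rule slice_less)
  note r = block_index(1)[OF k i]
  have bA: "bcirc A \<in> carrier_mat (m * p) (n * p)" using A by (rule bcirc_carrier)
  have uB: "t_unfold B \<in> carrier_mat (n * p) s" by (simp add: t_unfold_def tensor_dims[OF B])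
  have per: "t_entry A (int ?k - int l) i h = t_entry A (k - int l) i h" for l h
    using p_pos by (simp add: t_entry_def tensor_dims[OF A] mod_diff_left_eq)
  have "t_entry (A *\<^sub>T B) k i j = (bcirc A * t_unfold B) $$ (?k * m + i, j)"
    unfolding t_entry_def tensor_carrierD(1)[OF t_prod_carrier[OF A B]]
    using bA uB k i j p_pos by (simp add: t_prod_def t_fold_def tensor_dims[OF A])
  also have "\<dots> = (\<Sum>c<n * p. bcirc A $$ (?k * m + i, c) * t_unfold B $$ (c, j))"
    using bA uB r j by (auto simp: scalar_prod_def lessThan_atLeast0 intro!: sum.cong)
  also have "\<dots> = (\<Sum>c<n * p. t_entry A (k - int (c div n)) i (c mod n) * t_entry B (int (c div n)) (c mod n) j)"
  proof (rule sum.cong[OF refl])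
    fix c assume "c \<in> {..<n * p}"
    then have c: "c < n * p" by simp
    then have "c div n < p" by (simp add: less_mult_imp_div_less mult.commute)
    then have "t_unfold B $$ (c, j) = t_entry B (int (c div n)) (c mod n) j"
      using c j by (simp add: t_unfold_def tensor_dims[OF B] t_entry_def)
    moreover have "(?k * m + i) div m = ?k" "(?k * m + i) mod m = i" using i by auto
    ultimately show "bcirc A $$ (?k * m + i, c) * t_unfold B $$ (c, j) =
        t_entry A (k - int (c div n)) i (c mod n) * t_entry B (int (c div n)) (c mod n) j"
      using bcirc_index[OF A r c] by (simp only: per)
  qed
  also have "\<dots> = (\<Sum>l<p. \<Sum>h<n. t_entry A (k - int l) i h * t_entry B (int l) h j)"
    by (rule sum_div_mod)
  finally show ?thesis .
qed

section \<open>Ring laws of the T-product and transposition\<close>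

lemma t_entry_congr:
  assumes "T \<in> tensor_carrier m n p" "k mod int p = l mod int p"
  shows "t_entry T k i j = t_entry T l i j"
  using assms t_entry_mod by metis

text \<open>The substitution l -> k - l moves the plain index to the left factor. It is what makes
  tubes commute.\<close>

lemma t_entry_prod_flip:
  fixes A B :: "'a :: semiring_0 tensor"
  assumes A: "A \<in> tensor_carrier m n p" and B: "B \<in> tensor_carrier n s p"
    and ij: "i < m" "j < s"
  shows "t_entry (A *\<^sub>T B) k i j =
    (\<Sum>l<p. \<Sum>h<n. t_entry A (int l) i h * t_entry B (k - int l) h j)"
proof -
  let ?f = "\<lambda>x. \<Sum>h<n. t_entry A (k - x) i h * t_entry B x h j"
  have per: "?f (x mod int p) = ?f x" for x
    by (intro sum.cong refl arg_cong2[where f = "(*)"] t_entry_congr[OF A] t_entry_congr[OF B])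
      (simp_all add: mod_diff_right_eq)
  have "(\<Sum>l<p. ?f (k - int l)) = (\<Sum>l<p. ?f (int l))"
    by (rule sum_mod_reflect[where f = ?f, OF per])
  then show ?thesis using t_entry_prod[OF A B ij, of k] by simp
qed

text \<open>For fixed l, shifting the inner index g to g - l gives \<open>A\<close> the argument it
  has on the other side. What remains is to move the pair (g, r) outside the pair (l, h).\<close>

lemma t_prod_assoc:
  fixes A B C :: "'a :: semiring_0 tensor"
  assumes A: "A \<in> tensor_carrier m n p" and B: "B \<in> tensor_carrier n s p"
    and C: "C \<in> tensor_carrier s t p"
  shows "A *\<^sub>T B *\<^sub>T C = A *\<^sub>T (B *\<^sub>T C)"
proof (rule tensor_eqI[of _ m t])
  note AB = t_prod_carrier[OF A B] and BC = t_prod_carrier[OF B C]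
  show "A *\<^sub>T B *\<^sub>T C \<in> tensor_carrier m t p" "A *\<^sub>T (B *\<^sub>T C) \<in> tensor_carrier m t p"
    using t_prod_carrier[OF AB C] t_prod_carrier[OF A BC] .
  fix k i j assume i: "i < m" and j: "j < t"
  have "t_entry (A *\<^sub>T B *\<^sub>T C) k i j =
      (\<Sum>l<p. \<Sum>h<s. \<Sum>g<p. \<Sum>r<n. t_entry A (k - int l - int g) i r * t_entry B (int g) r h * t_entry C (int l) h j)"
    by (simp add: t_entry_prod[OF AB C i j] t_entry_prod[OF A B i] sum_distrib_right)
  also have "\<dots> = (\<Sum>l<p. \<Sum>h<s. \<Sum>g<p. \<Sum>r<n.
      t_entry A (k - int g) i r * t_entry B (int g - int l) r h * t_entry C (int l) h j)"
  proof (rule sum.cong[OF refl], rule sum.cong[OF refl])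
    fix l h
    let ?f = "\<lambda>x. \<Sum>r<n. t_entry A (k - int l - x) i r * t_entry B x r h * t_entry C (int l) h j"
    have per: "?f (x mod int p) = ?f x" for x
      by (intro sum.cong refl arg_cong2[where f = "(*)"] t_entry_congr[OF A] t_entry_congr[OF B])
        (simp_all add: mod_diff_right_eq)
    show "(\<Sum>g<p. ?f (int g)) = (\<Sum>g<p. \<Sum>r<n.
      t_entry A (k - int g) i r * t_entry B (int g - int l) r h * t_entry C (int l) h j)"
      using sum_mod_shift[where f = ?f and c = "int l", OF per] by simp
  qed
  also have "\<dots> = (\<Sum>g<p. \<Sum>r<n. \<Sum>l<p. \<Sum>h<s.
      t_entry A (k - int g) i r * t_entry B (int g - int l) r h * t_entry C (int l) h j)"
  proof -
    have 1: "(\<Sum>l<p. \<Sum>h<s. \<Sum>g<p. X l h g) = (\<Sum>g<p. \<Sum>l<p. \<Sum>h<s. X l h g)" for X :: "nat \<Rightarrow> nat \<Rightarrow> nat \<Rightarrow> 'a"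
      by (rule trans[OF sum.cong[OF refl sum.swap] sum.swap])
    have 2: "(\<Sum>l<p. \<Sum>h<s. \<Sum>r<n. X l h r) = (\<Sum>r<n. \<Sum>l<p. \<Sum>h<s. X l h r)" for X :: "nat \<Rightarrow> nat \<Rightarrow> nat \<Rightarrow> 'a"
      by (rule trans[OF sum.cong[OF refl sum.swap] sum.swap])
    show ?thesis by (rule trans[OF 1 sum.cong[OF refl 2]])
  qed
  also have "\<dots> = t_entry (A *\<^sub>T (B *\<^sub>T C)) k i j"
    by (simp add: t_entry_prod[OF A BC i j] t_entry_prod[OF B C _ j] sum_distrib_left mult.assoc)
  finally show "t_entry (A *\<^sub>T B *\<^sub>T C) k i j = t_entry (A *\<^sub>T (B *\<^sub>T C)) k i j" .
qed

lemmas t_carriers = t_add_carrier t_minus_carrier t_smult_carrier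
  t_prod_carrier t_transpose_carrier t_id_carrier

lemma t_prod_add_left:
  fixes A B C :: "'a :: semiring_0 tensor"
  assumes A: "A \<in> tensor_carrier m n p" and B: "B \<in> tensor_carrier m n p"
    and C: "C \<in> tensor_carrier n s p"
  shows "(A +\<^sub>T B) *\<^sub>T C = A *\<^sub>T C +\<^sub>T B *\<^sub>T C"
proof (rule tensor_eqI)
  note AB = t_add_carrier[OF A B]
  note AC = t_prod_carrier[OF A C] and BC = t_prod_carrier[OF B C]
  show "(A +\<^sub>T B) *\<^sub>T C \<in> tensor_carrier m s p" by (rule t_prod_carrier[OF AB C])
  show "A *\<^sub>T C +\<^sub>T B *\<^sub>T C \<in> tensor_carrier m s p" by (rule t_add_carrier[OF AC BC])
  fix k i j assume ij: "i < m" "j < s"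
  then show "t_entry ((A +\<^sub>T B) *\<^sub>T C) k i j = t_entry (A *\<^sub>T C +\<^sub>T B *\<^sub>T C) k i j"
    by (simp add: t_entry_add[OF AC BC] t_entry_prod[OF A C] t_entry_prod[OF B C] t_entry_prod[OF AB C]
        t_entry_add[OF A B] distrib_right sum.distrib)
qed

lemma t_prod_add_right:
  fixes A B C :: "'a :: semiring_0 tensor"
  assumes A: "A \<in> tensor_carrier m n p" and B: "B \<in> tensor_carrier n s p"
    and C: "C \<in> tensor_carrier n s p"
  shows "A *\<^sub>T (B +\<^sub>T C) = A *\<^sub>T B +\<^sub>T A *\<^sub>T C"
proof (rule tensor_eqI)
  note BC = t_add_carrier[OF B C]
  note AB = t_prod_carrier[OF A B] and AC = t_prod_carrier[OF A C]
  show "A *\<^sub>T (B +\<^sub>T C) \<in> tensor_carrier m s p" by (rule t_prod_carrier[OF A BC])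
  show "A *\<^sub>T B +\<^sub>T A *\<^sub>T C \<in> tensor_carrier m s p" by (rule t_add_carrier[OF AB AC])
  fix k i j assume ij: "i < m" "j < s"
  then show "t_entry (A *\<^sub>T (B +\<^sub>T C)) k i j = t_entry (A *\<^sub>T B +\<^sub>T A *\<^sub>T C) k i j"
    by (simp add: t_entry_add[OF AB AC] t_entry_prod[OF A C] t_entry_prod[OF A B] t_entry_prod[OF A BC]
        t_entry_add[OF B C] distrib_left sum.distrib)
qed

lemma t_prod_minus_right:
  fixes A B C :: "'a :: ring tensor"
  assumes A: "A \<in> tensor_carrier m n p" and B: "B \<in> tensor_carrier n s p"
    and C: "C \<in> tensor_carrier n s p"
  shows "A *\<^sub>T (B -\<^sub>T C) = A *\<^sub>T B -\<^sub>T A *\<^sub>T C"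
proof (rule tensor_eqI)
  note BC = t_minus_carrier[OF B C]
  note AB = t_prod_carrier[OF A B] and AC = t_prod_carrier[OF A C]
  show "A *\<^sub>T (B -\<^sub>T C) \<in> tensor_carrier m s p" by (rule t_prod_carrier[OF A BC])
  show "A *\<^sub>T B -\<^sub>T A *\<^sub>T C \<in> tensor_carrier m s p" by (rule t_minus_carrier[OF AB AC])
  fix k i j assume ij: "i < m" "j < s"
  then show "t_entry (A *\<^sub>T (B -\<^sub>T C)) k i j = t_entry (A *\<^sub>T B -\<^sub>T A *\<^sub>T C) k i j"
    by (simp add: t_entry_minus[OF AB AC] t_entry_prod[OF A C] t_entry_prod[OF A B] t_entry_prod[OF A BC]
        t_entry_minus[OF B C] right_diff_distrib sum_subtractf)
qed

lemma t_prod_minus_left: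
  fixes A B C :: "'a :: ring tensor"
  assumes A: "A \<in> tensor_carrier m n p" and B: "B \<in> tensor_carrier m n p"
    and C: "C \<in> tensor_carrier n s p"
  shows "(A -\<^sub>T B) *\<^sub>T C = A *\<^sub>T C -\<^sub>T B *\<^sub>T C"
proof (rule tensor_eqI)
  note AB = t_minus_carrier[OF A B]
  note AC = t_prod_carrier[OF A C] and BC = t_prod_carrier[OF B C]
  show "(A -\<^sub>T B) *\<^sub>T C \<in> tensor_carrier m s p" by (rule t_prod_carrier[OF AB C])
  show "A *\<^sub>T C -\<^sub>T B *\<^sub>T C \<in> tensor_carrier m s p" by (rule t_minus_carrier[OF AC BC])
  fix k i j assume ij: "i < m" "j < s"
  then show "t_entry ((A -\<^sub>T B) *\<^sub>T C) k i j = t_entry (A *\<^sub>T C -\<^sub>T B *\<^sub>T C) k i j"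
    by (simp add: t_entry_minus[OF AC BC] t_entry_prod[OF A C] t_entry_prod[OF B C] t_entry_prod[OF AB C]
        t_entry_minus[OF A B] left_diff_distrib sum_subtractf)
qed

lemma t_prod_smult_left:
  fixes A B :: "'a :: semiring_0 tensor"
  assumes A: "A \<in> tensor_carrier m n p" and B: "B \<in> tensor_carrier n s p"
  shows "(c \<cdot>\<^sub>T A) *\<^sub>T B = c \<cdot>\<^sub>T (A *\<^sub>T B)"
proof (rule tensor_eqI)
  note AB = t_prod_carrier[OF A B] and cA = t_smult_carrier[OF A, of c]
  show "(c \<cdot>\<^sub>T A) *\<^sub>T B \<in> tensor_carrier m s p" by (rule t_prod_carrier[OF cA B])
  show "c \<cdot>\<^sub>T (A *\<^sub>T B) \<in> tensor_carrier m s p" by (rule t_smult_carrier[OF AB])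
  fix k i j assume ij: "i < m" "j < s"
  then show "t_entry ((c \<cdot>\<^sub>T A) *\<^sub>T B) k i j = t_entry (c \<cdot>\<^sub>T (A *\<^sub>T B)) k i j"
    by (simp add: t_entry_smult[OF AB] t_entry_prod[OF A B] t_entry_prod[OF cA B]
        t_entry_smult[OF A] sum_distrib_left mult.assoc)
qed

lemma t_prod_smult_right:
  fixes A B :: "'a :: comm_semiring_0 tensor"
  assumes A: "A \<in> tensor_carrier m n p" and B: "B \<in> tensor_carrier n s p"
  shows "A *\<^sub>T (c \<cdot>\<^sub>T B) = c \<cdot>\<^sub>T (A *\<^sub>T B)"
proof (rule tensor_eqI)
  note AB = t_prod_carrier[OF A B] and cB = t_smult_carrier[OF B, of c]
  show "A *\<^sub>T (c \<cdot>\<^sub>T B) \<in> tensor_carrier m s p" by (rule t_prod_carrier[OF A cB])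
  show "c \<cdot>\<^sub>T (A *\<^sub>T B) \<in> tensor_carrier m s p" by (rule t_smult_carrier[OF AB])
  fix k i j assume ij: "i < m" "j < s"
  then show "t_entry (A *\<^sub>T (c \<cdot>\<^sub>T B)) k i j = t_entry (c \<cdot>\<^sub>T (A *\<^sub>T B)) k i j"
    by (simp add: t_entry_smult[OF AB] t_entry_prod[OF A B] t_entry_prod[OF A cB]
        t_entry_smult[OF B] sum_distrib_left mult.left_commute)
qed

lemma t_transpose_transpose:
  assumes A: "A \<in> tensor_carrier m n p"
  shows "(A\<^sup>\<top>)\<^sup>\<top> = A"
  by (rule tensor_eqI[of _ m n])
    (simp_all add: A t_transpose_carrier t_entry_transpose[OF A]
      t_entry_transpose[OF t_transpose_carrier[OF A]])

lemma t_transpose_minus: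
  assumes A: "A \<in> tensor_carrier m n p" and B: "B \<in> tensor_carrier m n p"
  shows "(A -\<^sub>T B)\<^sup>\<top> = A\<^sup>\<top> -\<^sub>T B\<^sup>\<top>"
  by (rule tensor_eqI[of _ n m])
    (simp_all add: t_carriers A B t_entry_transpose[OF A] t_entry_transpose[OF B]
      t_entry_transpose[OF t_minus_carrier[OF A B]] t_entry_minus[OF A B]
      t_entry_minus[OF t_transpose_carrier[OF A] t_transpose_carrier[OF B]])

lemma t_transpose_add:
  assumes A: "A \<in> tensor_carrier m n p" and B: "B \<in> tensor_carrier m n p"
  shows "(A +\<^sub>T B)\<^sup>\<top> = A\<^sup>\<top> +\<^sub>T B\<^sup>\<top>"
  by (rule tensor_eqI[of _ n m])
    (simp_all add: t_carriers A B t_entry_transpose[OF A] t_entry_transpose[OF B]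
      t_entry_transpose[OF t_add_carrier[OF A B]] t_entry_add[OF A B]
      t_entry_add[OF t_transpose_carrier[OF A] t_transpose_carrier[OF B]])

lemma t_transpose_smult:
  assumes A: "A \<in> tensor_carrier m n p"
  shows "(c \<cdot>\<^sub>T A)\<^sup>\<top> = c \<cdot>\<^sub>T A\<^sup>\<top>"
  by (rule tensor_eqI[of _ n m])
    (simp_all add: t_carriers A t_entry_transpose[OF A]
      t_entry_transpose[OF t_smult_carrier[OF A]] t_entry_smult[OF A]
      t_entry_smult[OF t_transpose_carrier[OF A]])

lemma t_transpose_prod:
  fixes A B :: "'a :: comm_semiring_0 tensor"
  assumes A: "A \<in> tensor_carrier m n p" and B: "B \<in> tensor_carrier n s p"
  shows "(A *\<^sub>T B)\<^sup>\<top> = B\<^sup>\<top> *\<^sub>T A\<^sup>\<top>"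
proof (rule tensor_eqI)
  note AB = t_prod_carrier[OF A B]
  note At = t_transpose_carrier[OF A] and Bt = t_transpose_carrier[OF B]
  show "(A *\<^sub>T B)\<^sup>\<top> \<in> tensor_carrier s m p" by (rule t_transpose_carrier[OF AB])
  show "B\<^sup>\<top> *\<^sub>T A\<^sup>\<top> \<in> tensor_carrier s m p" by (rule t_prod_carrier[OF Bt At])
  fix k i j assume i: "i < s" and j: "j < m"
  let ?f = "\<lambda>x. \<Sum>h<n. t_entry A (- k - x) j h * t_entry B x h i"
  have per: "?f (x mod int p) = ?f x" for x
    by (intro sum.cong refl arg_cong2[where f = "(*)"] t_entry_congr[OF A] t_entry_congr[OF B])
      (simp_all add: mod_diff_right_eq)
  \<comment> \<open>Both transposes reflect their slice index, which produces the summand of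
    \<open>A *\<^sub>T B\<close> at -k, shifted by k.\<close>
  have "t_entry (B\<^sup>\<top> *\<^sub>T A\<^sup>\<top>) k i j = (\<Sum>l<p. ?f (int l - k))"
    using i j by (simp add: t_entry_prod[OF Bt At] t_entry_transpose[OF A]
        t_entry_transpose[OF B] mult.commute)
  also have "\<dots> = (\<Sum>l<p. ?f (int l))" by (rule sum_mod_shift[where f = ?f, OF per])
  also have "\<dots> = t_entry ((A *\<^sub>T B)\<^sup>\<top>) k i j"
    using i j by (simp add: t_entry_transpose[OF AB] t_entry_prod[OF A B])
  finally show "t_entry ((A *\<^sub>T B)\<^sup>\<top>) k i j = t_entry (B\<^sup>\<top> *\<^sub>T A\<^sup>\<top>) k i j" by simp
qed

lemma t_transpose_id: "(t_id n p)\<^sup>\<top> = (t_id n p :: 'a :: zero_neq_one tensor)"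
  by (rule tensor_eqI[of _ n n])
    (auto simp: t_carriers t_entry_transpose[OF t_id_carrier] t_entry_id)

lemma t_prod_id_right:
  fixes A :: "'a :: semiring_1 tensor"
  assumes A: "A \<in> tensor_carrier m n p"
  shows "A *\<^sub>T t_id n p = A"
proof (rule tensor_eqI)
  show "A *\<^sub>T t_id n p \<in> tensor_carrier m n p" by (rule t_prod_carrier[OF A t_id_carrier])
  show "A \<in> tensor_carrier m n p" by (rule A)
  fix k i j assume ij: "i < m" "j < n"
  have "t_entry (A *\<^sub>T t_id n p) k i j =
      (\<Sum>l<p. \<Sum>h<n. if h = j then (if l = 0 then t_entry A k i j else 0) else 0)"
    unfolding t_entry_prod[OF A t_id_carrier ij]
  proof (intro sum.cong refl)
    fix l h assume "l \<in> {..<p}" "h \<in> {..<n}"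
    moreover have "int p dvd int l \<longleftrightarrow> l = 0" if "l < p" for l
      using that by (auto dest: nat_dvd_not_less)
    ultimately show "t_entry A (k - int l) i h * t_entry (t_id n p) (int l) h j =
        (if h = j then (if l = 0 then t_entry A k i j else 0) else 0)"
      using ij by (auto simp: t_entry_id)
  qed
  then show "t_entry (A *\<^sub>T t_id n p) k i j = t_entry A k i j"
    using ij p_pos by (simp add: sum.delta)
qed

lemma t_prod_id_left:
  fixes A :: "'a :: comm_semiring_1 tensor"
  assumes A: "A \<in> tensor_carrier m n p"
  shows "t_id m p *\<^sub>T A = A"
proof -
  have "t_id m p *\<^sub>T A = (A\<^sup>\<top> *\<^sub>T t_id m p)\<^sup>\<top>"
    using t_transpose_prod[OF t_transpose_carrier[OF A] t_id_carrier]
    by (simp add: t_transpose_id t_transpose_transpose[OF A])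
  then show ?thesis
    by (simp add: t_prod_id_right[OF t_transpose_carrier[OF A]] t_transpose_transpose[OF A])
qed

text \<open>With scalar entries the product is a cyclic convolution over a commutative semiring; one
  side is written with the flipped index.\<close>

lemma tube_prod_commute:
  fixes a b :: "'a :: comm_semiring_0 tensor"
  assumes a: "a \<in> tensor_carrier 1 1 p" and b: "b \<in> tensor_carrier 1 1 p"
  shows "a *\<^sub>T b = b *\<^sub>T a"
  by (rule tensor_eqI[of _ 1 1])
    (simp_all add: t_entry_prod[OF a b] t_entry_prod_flip[OF b a] mult.commute
       t_prod_carrier[OF a b] t_prod_carrier[OF b a] del: One_nat_def)

section \<open>Inverses, and tubes as vectors\<close>

lemma t_inverse_eqI:
  fixes S C :: "'a :: semiring_1 tensor"
  assumes S: "S \<in> tensor_carrier n n p" and inv: "is_t_inverse S C"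
  shows "t_inverse S = C"
  unfolding t_inverse_def
proof (rule the_equality)
  note C = inv[unfolded is_t_inverse_def tensor_dims[OF S]]
  fix D assume "is_t_inverse S D"
  note D = this[unfolded is_t_inverse_def tensor_dims[OF S]]
  have "D = D *\<^sub>T (S *\<^sub>T C)" using C D by (simp add: t_prod_id_right[of D n n])
  also have "\<dots> = (D *\<^sub>T S) *\<^sub>T C" using t_prod_assoc[of D n n S n C n] S C D by simp
  also have "\<dots> = t_id n p *\<^sub>T C" using D by simp
  \<comment> \<open>Rewriting the identity as \<open>C *\<^sub>T S\<close> lets the right unit law
    finish the argument; the left unit law was obtained by transposition, over a commutative
    semiring.\<close>
  also have "\<dots> = C *\<^sub>T S *\<^sub>T C" using C by simp
  also have "\<dots> = C *\<^sub>T (S *\<^sub>T C)" using t_prod_assoc[of C n n S n C n] S C by simp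
  also have "\<dots> = C" using C by (simp add: t_prod_id_right[of C n n])
  finally show "D = C" .
qed (rule inv)

definition tube :: "'a vec \<Rightarrow> 'a tensor" where
  "tube v = map (\<lambda>k. mat 1 1 (\<lambda>_. v $ k)) [0..<p]"

lemma tube_carrier: "tube v \<in> tensor_carrier 1 1 p"
  by (auto intro!: tensor_carrierI simp: tube_def)

lemma t_entry_tube: "l < p \<Longrightarrow> t_entry (tube v) (int l) 0 0 = v $ l"
  by (simp add: t_entry_nth tube_def)

text \<open>The unfolding of a tube is a vector, so multiplication by a tube is a linear map with
  matrix \<open>bcirc S\<close>. This opens tubes to determinants.\<close>

lemma bcirc_mult_vec:
  fixes S :: "'a :: semiring_0 tensor"
  assumes S: "S \<in> tensor_carrier 1 1 p" and v: "v \<in> carrier_vec p" and r: "r < p"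
  shows "(bcirc S *\<^sub>v v) $ r = t_entry (S *\<^sub>T tube v) (int r) 0 0"
proof -
  have bS: "bcirc S \<in> carrier_mat p p" using bcirc_carrier[OF S] by simp
  have "(bcirc S *\<^sub>v v) $ r = (\<Sum>c<p. bcirc S $$ (r, c) * v $ c)"
    using bS v r by (auto simp: scalar_prod_def lessThan_atLeast0 intro!: sum.cong)
  also have "\<dots> = (\<Sum>c<p. t_entry S (int r - int c) 0 0 * t_entry (tube v) (int c) 0 0)"
    using bcirc_index[OF S, of r] r by (intro sum.cong) (auto simp: t_entry_tube)
  finally show ?thesis by (simp add: t_entry_prod[OF S tube_carrier])
qed

text \<open>Periodicity reduces every index to a slice in range. This form serves tensors whose
  entries are known only there, such as \<open>t_unit\<close> and \<open>t_dft\<close>.\<close>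

lemma tensor_eqI_nat:
  assumes S: "S \<in> tensor_carrier m n p" and T: "T \<in> tensor_carrier m n p"
    and eq: "\<And>l i j. l < p \<Longrightarrow> i < m \<Longrightarrow> j < n \<Longrightarrow> t_entry S (int l) i j = t_entry T (int l) i j"
  shows "S = T"
proof (rule tensor_eqI[OF S T])
  fix k i j assume "i < m" "j < n"
  then show "t_entry S k i j = t_entry T k i j"
    using eq[OF slice_less[of k]] p_pos
    by (simp add: t_entry_mod[OF S] t_entry_mod[OF T])
qed

text \<open>In finite dimension a trivial kernel suffices: a singular \<open>bcirc S\<close> would
  have a nonzero null vector, and that vector is a tube annihilated by \<open>S\<close>.\<close>

lemma tube_invertibleI:
  fixes S :: "'a :: field tensor"
  assumes S: "S \<in> tensor_carrier 1 1 p"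
    and inj: "\<And>c. c \<in> tensor_carrier 1 1 p \<Longrightarrow> (\<And>k. t_entry (S *\<^sub>T c) k 0 0 = 0) \<Longrightarrow> (\<And>k. t_entry c k 0 0 = 0)"
  shows "t_invertible S"
proof -
  have bS: "bcirc S \<in> carrier_mat p p" using bcirc_carrier[OF S] by simp
  have "det (bcirc S) \<noteq> 0"
  proof
    assume "det (bcirc S) = 0"
    then obtain v where v: "v \<in> carrier_vec p" "v \<noteq> 0\<^sub>v p" "bcirc S *\<^sub>v v = 0\<^sub>v p"
      using det_0_iff_vec_prod_zero_field[OF bS] by blast
    have "t_entry (S *\<^sub>T tube v) k 0 0 = 0" for k
      using bcirc_mult_vec[OF S v(1) slice_less[of k]] v(3) slice_less[of k] p_pos
      by (simp add: t_entry_mod[OF t_prod_carrier[OF S tube_carrier]])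
    then have "t_entry (tube v) k 0 0 = 0" for k by (rule inj[OF tube_carrier])
    then have "v $ l = 0" if "l < p" for l using t_entry_tube[OF that, of v] by simp
    then have "v = 0\<^sub>v p" using v(1) by auto
    with v(2) show False ..
  qed
  then obtain N where N: "N \<in> carrier_mat p p" "bcirc S * N = 1\<^sub>m p"
    using det_non_zero_imp_unit[OF bS, of "()"]
    by (auto simp: Units_def ring_mat_def)
  \<comment> \<open>The identity tube unfolds to the first unit vector, so its preimage under
    \<open>bcirc S\<close> is the first column of the inverse matrix.\<close>
  let ?C = "tube (col N 0)"
  have SC: "S *\<^sub>T ?C = t_id 1 p"
  proof (rule tensor_eqI_nat)
    show "S *\<^sub>T ?C \<in> tensor_carrier 1 1 p" by (rule t_prod_carrier[OF S tube_carrier])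
    show "t_id 1 p \<in> tensor_carrier 1 1 p" by (rule t_id_carrier)
    fix l and i j :: nat assume l: "l < p" and "i < 1" "j < 1"
    then have [simp]: "i = 0" "j = 0" by simp_all
    have c: "col N 0 \<in> carrier_vec p" using N by auto
    have "t_entry (S *\<^sub>T ?C) (int l) 0 0 = (bcirc S * N) $$ (l, 0)"
      using bcirc_mult_vec[OF S c l] bS N(1) l p_pos by simp
    also have "\<dots> = t_entry (t_id 1 p) (int l) 0 0"
      using l p_pos unfolding N(2) by (auto simp: t_entry_id dest: nat_dvd_not_less)
    finally show "t_entry (S *\<^sub>T ?C) (int l) i j = t_entry (t_id 1 p) (int l) i j" by simp
  qed
  then have "?C *\<^sub>T S = t_id 1 p" using tube_prod_commute[OF S tube_carrier] by simp
  with SC show ?thesis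
    unfolding t_invertible_def is_t_inverse_def tensor_dims[OF S]
    using S tube_carrier by blast
qed

section \<open>Frobenius inner product and adjoints\<close>

lemma t_inner_entry:
  assumes Y: "Y \<in> tensor_carrier m n p" and Z: "Z \<in> tensor_carrier m n p"
  shows "t_inner Y Z = (\<Sum>k<p. \<Sum>i<m. \<Sum>j<n. t_entry Y (int k) i j * t_entry Z (int k) i j)"
  unfolding t_inner_def tensor_dims[OF Y]
  by (intro sum.cong refl) (simp add: t_entry_nth tensor_dims[OF Y] tensor_dims[OF Z])

lemma t_inner_commute:
  assumes Y: "Y \<in> tensor_carrier m n p" and Z: "Z \<in> tensor_carrier m n p"
  shows "t_inner Y Z = t_inner Z Y"
  by (simp add: t_inner_entry[OF Y Z] t_inner_entry[OF Z Y] mult.commute)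

lemma t_inner_add_right:
  assumes Y: "Y \<in> tensor_carrier m n p" and Z: "Z \<in> tensor_carrier m n p"
    and W: "W \<in> tensor_carrier m n p"
  shows "t_inner Y (Z +\<^sub>T W) = t_inner Y Z + t_inner Y W"
  by (simp add: t_inner_entry[OF Y Z] t_inner_entry[OF Y W]
      t_inner_entry[OF Y t_add_carrier[OF Z W]] t_entry_add[OF Z W]
      distrib_left sum.distrib)

lemma t_inner_smult_right:
  assumes Y: "Y \<in> tensor_carrier m n p" and Z: "Z \<in> tensor_carrier m n p"
  shows "t_inner Y (c \<cdot>\<^sub>T Z) = c * t_inner Y Z"
  by (simp add: t_inner_entry[OF Y Z] t_inner_entry[OF Y t_smult_carrier[OF Z]]
      t_entry_smult[OF Z] mult.left_commute sum_distrib_left)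

lemma t_inner_self_eq_0:
  assumes Y: "Y \<in> tensor_carrier m n p" and 0: "t_inner Y Y = 0" and ij: "i < m" "j < n"
  shows "t_entry Y k i j = 0"
proof -
  let ?k = "nat (k mod int p)"
  have "\<forall>k<p. \<forall>i<m. \<forall>j<n. t_entry Y (int k) i j * t_entry Y (int k) i j = 0"
    using 0 unfolding t_inner_entry[OF Y Y]
    by (simp add: sum_nonneg_eq_0_iff sum_nonneg)
  then have "t_entry Y (int ?k) i j = 0" using ij slice_less[of k] by auto
  then show ?thesis using p_pos by (simp add: t_entry_mod[OF Y])
qed

text \<open>Transposition only permutes the entries: i and j trade places and k becomes -k, the same
  for both arguments.\<close>

lemma t_inner_transpose:
  assumes Y: "Y \<in> tensor_carrier m n p" and Z: "Z \<in> tensor_carrier m n p"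
  shows "t_inner (Y\<^sup>\<top>) (Z\<^sup>\<top>) = t_inner Y Z"
proof -
  let ?f = "\<lambda>x. \<Sum>i<m. \<Sum>j<n. t_entry Y x i j * t_entry Z x i j"
  have per: "?f (x mod int p) = ?f x" for x
    by (simp add: t_entry_mod[OF Y] t_entry_mod[OF Z])
  have "t_inner (Y\<^sup>\<top>) (Z\<^sup>\<top>) = (\<Sum>k<p. \<Sum>j<n. \<Sum>i<m. t_entry Y (0 - int k) i j * t_entry Z (0 - int k) i j)"
    by (simp add: t_inner_entry[OF t_transpose_carrier[OF Y] t_transpose_carrier[OF Z]]
        t_entry_transpose[OF Y] t_entry_transpose[OF Z])
  also have "\<dots> = (\<Sum>k<p. ?f (0 - int k))" by (rule sum.cong[OF refl sum.swap])
  also have "\<dots> = (\<Sum>k<p. ?f (int k))" by (rule sum_mod_reflect[where f = ?f, OF per])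
  finally show ?thesis by (simp add: t_inner_entry[OF Y Z])
qed

text \<open>Both sides are the same fivefold sum, because the transpose turns the slice index l - k
  back into k - l.\<close>

lemma t_inner_prod_left:
  assumes A: "A \<in> tensor_carrier m n p" and Z: "Z \<in> tensor_carrier n s p"
    and Y: "Y \<in> tensor_carrier m s p"
  shows "t_inner Y (A *\<^sub>T Z) = t_inner (A\<^sup>\<top> *\<^sub>T Y) Z"
proof -
  note At = t_transpose_carrier[OF A]
  let ?F = "\<lambda>k i j l h. t_entry Y (int k) i j * (t_entry A (int k - int l) i h * t_entry Z (int l) h j)"
  have "t_inner Y (A *\<^sub>T Z) = (\<Sum>k<p. \<Sum>i<m. \<Sum>j<s. \<Sum>l<p. \<Sum>h<n. ?F k i j l h)"
    by (simp add: t_inner_entry[OF Y t_prod_carrier[OF A Z]] t_entry_prod[OF A Z] sum_distrib_left)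
  \<comment> \<open>Bundling (k, i) and (l, h) into pairs reduces the exchange to a triple sum with
    j in the middle.\<close>
  also have "\<dots> = (\<Sum>x\<in>{..<p}\<times>{..<m}. \<Sum>j<s. \<Sum>y\<in>{..<p}\<times>{..<n}. ?F (fst x) (snd x) j (fst y) (snd y))"
    by (simp add: sum.cartesian_product')
  also have "\<dots> = (\<Sum>y\<in>{..<p}\<times>{..<n}. \<Sum>j<s. \<Sum>x\<in>{..<p}\<times>{..<m}. ?F (fst x) (snd x) j (fst y) (snd y))"
    by (rule sum_swap3)
  also have "\<dots> = (\<Sum>l<p. \<Sum>h<n. \<Sum>j<s. \<Sum>k<p. \<Sum>i<m. ?F k i j l h)"
    by (simp add: sum.cartesian_product')
  also have "\<dots> = t_inner (A\<^sup>\<top> *\<^sub>T Y) Z"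
    by (simp add: t_inner_entry[OF t_prod_carrier[OF At Y] Z] t_entry_prod[OF At Y]
        t_entry_transpose[OF A] sum_distrib_right sum_distrib_left mult_ac)
  finally show ?thesis .
qed

text \<open>Transposing both arguments turns right multiplication by \<open>X\<close> into left
  multiplication by its transpose, where the previous adjointness applies.\<close>

lemma t_inner_prod_right:
  assumes Z: "Z \<in> tensor_carrier m n p" and X: "X \<in> tensor_carrier n s p"
    and Y: "Y \<in> tensor_carrier m s p"
  shows "t_inner Y (Z *\<^sub>T X) = t_inner (Y *\<^sub>T X\<^sup>\<top>) Z"
proof -
  note Xt = t_transpose_carrier[OF X] and Yt = t_transpose_carrier[OF Y]
    and Zt = t_transpose_carrier[OF Z]
  have "t_inner Y (Z *\<^sub>T X) = t_inner (Y\<^sup>\<top>) ((Z *\<^sub>T X)\<^sup>\<top>)"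
    by (rule t_inner_transpose[symmetric, OF Y t_prod_carrier[OF Z X]])
  also have "\<dots> = t_inner (X *\<^sub>T Y\<^sup>\<top>) (Z\<^sup>\<top>)"
    by (simp add: t_transpose_prod[OF Z X] t_inner_prod_left[OF Xt Zt Yt] t_transpose_transpose[OF X])
  also have "X *\<^sub>T Y\<^sup>\<top> = (Y *\<^sub>T X\<^sup>\<top>)\<^sup>\<top>"
    by (simp add: t_transpose_prod[OF Y Xt] t_transpose_transpose[OF X])
  also have "t_inner \<dots> (Z\<^sup>\<top>) = t_inner (Y *\<^sub>T X\<^sup>\<top>) Z"
    by (rule t_inner_transpose[OF t_prod_carrier[OF Y Xt] Z])
  finally show ?thesis .
qed

lemma t_invertible_id_plus_gram:
  fixes X :: "real tensor"
  assumes X: "X \<in> tensor_carrier n 1 p"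
  shows "t_invertible (t_id 1 p +\<^sub>T X\<^sup>\<top> *\<^sub>T X)"
proof (rule tube_invertibleI)
  note Xt = t_transpose_carrier[OF X]
  note G = t_prod_carrier[OF Xt X] and I = t_id_carrier[of 1]
  let ?S = "t_id 1 p +\<^sub>T X\<^sup>\<top> *\<^sub>T X"
  show S: "?S \<in> tensor_carrier 1 1 p" by (rule t_add_carrier[OF I G])
  fix c k assume c: "c \<in> tensor_carrier 1 1 p" and 0: "\<And>k. t_entry (?S *\<^sub>T c) k 0 0 = 0"
  note Xc = t_prod_carrier[OF X c]
  have "?S *\<^sub>T c = c +\<^sub>T X\<^sup>\<top> *\<^sub>T (X *\<^sub>T c)"
    by (simp only: t_prod_add_left[OF I G c] t_prod_id_left[OF c] t_prod_assoc[OF Xt X c])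
  then have "t_inner c (?S *\<^sub>T c) = t_inner c c + t_inner (X *\<^sub>T c) (X *\<^sub>T c)"
    by (simp add: t_inner_add_right[OF c c t_prod_carrier[OF Xt Xc]]
        t_inner_prod_left[OF Xt Xc c] t_transpose_transpose[OF X])
  moreover have "t_inner c (?S *\<^sub>T c) = 0"
    by (simp add: t_inner_entry[OF c t_prod_carrier[OF S c]] 0 del: One_nat_def)
  ultimately have "t_inner c c = 0"
    using t_inner_self_nonneg[of c] t_inner_self_nonneg[of "X *\<^sub>T c"] by linarith
  then show "t_entry c k 0 0 = 0" by (rule t_inner_self_eq_0[OF c]) simp_all
qed

subsection \<open>Stationarity of the Lagrangian\<close>

definition t_unit :: "nat \<Rightarrow> nat \<Rightarrow> nat \<Rightarrow> nat \<Rightarrow> nat \<Rightarrow> 'a :: zero_neq_one tensor" where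
  "t_unit m n i j k = map (\<lambda>l. mat m n (\<lambda>x. if l = k \<and> x = (i, j) then 1 else 0)) [0..<p]"

lemma t_unit_carrier: "t_unit m n i j k \<in> tensor_carrier m n p"
  by (auto intro!: tensor_carrierI simp: t_unit_def)

lemma t_entry_unit:
  "l < p \<Longrightarrow> i' < m \<Longrightarrow> j' < n \<Longrightarrow>
    t_entry (t_unit m n i j k) (int l) i' j' = (if l = k \<and> i' = i \<and> j' = j then 1 else 0)"
  by (simp add: t_entry_nth t_unit_def)

text \<open>A partial derivative becomes a derivative along a basis tensor, so the change of an
  entry can be pushed through products bilinearly.\<close>

lemma t_update_eq:
  fixes T :: "real tensor"
  assumes T: "T \<in> tensor_carrier m n p" and k: "k < p"
  shows "t_update T i j k t = T +\<^sub>T (t - T ! k $$ (i, j)) \<cdot>\<^sub>T t_unit m n i j k"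
proof (rule tensor_eqI_nat)
  note U = t_smult_carrier[OF t_unit_carrier]
  show c: "t_update T i j k t \<in> tensor_carrier m n p"
    using tensor_carrierD[OF T] k
    by (intro tensor_carrierI) (auto simp: t_update_def tensor_dims[OF T] nth_list_update)
  show "T +\<^sub>T (t - T ! k $$ (i, j)) \<cdot>\<^sub>T t_unit m n i j k \<in> tensor_carrier m n p"
    by (rule t_add_carrier[OF T U])
  fix l i' j' assume "l < p" "i' < m" "j' < n"
  then show "t_entry (t_update T i j k t) (int l) i' j' =
      t_entry (T +\<^sub>T (t - T ! k $$ (i, j)) \<cdot>\<^sub>T t_unit m n i j k) (int l) i' j'"
    using k by (simp add: t_entry_add[OF T U] t_entry_smult[OF t_unit_carrier] t_entry_unit)
      (auto simp: t_entry_nth t_update_def tensor_dims[OF T] tensor_dims[OF c] nth_list_update)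
qed

text \<open>Pairings with all basis tensors determine a tensor; this converts vanishing linear
  coefficients into entrywise equations.\<close>

lemma t_inner_unit:
  assumes Y: "Y \<in> tensor_carrier m n p" and "i < m" "j < n" "k < p"
  shows "t_inner Y (t_unit m n i j k) = t_entry Y (int k) i j"
proof -
  have "t_inner Y (t_unit m n i j k) =
      (\<Sum>l<p. \<Sum>i'<m. \<Sum>j'<n. if j' = j then if i' = i then if l = k then t_entry Y (int k) i j else 0 else 0 else 0)"
    unfolding t_inner_entry[OF Y t_unit_carrier]
    by (intro sum.cong refl) (auto simp: t_entry_unit)
  then show ?thesis using assms by simp
qed

lemma t_inner_perturb:
  assumes Y: "Y \<in> tensor_carrier m n p" and W: "W \<in> tensor_carrier m n p"
  shows "t_inner (Y +\<^sub>T u \<cdot>\<^sub>T W) (Y +\<^sub>T u \<cdot>\<^sub>T W) = t_inner Y Y + u * (2 * t_inner Y W) + u\<^sup>2 * t_inner W W"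
proof -
  note uW = t_smult_carrier[OF W, of u]
  note S = t_add_carrier[OF Y uW]
  have "t_inner (Y +\<^sub>T u \<cdot>\<^sub>T W) (Y +\<^sub>T u \<cdot>\<^sub>T W) = t_inner Y (Y +\<^sub>T u \<cdot>\<^sub>T W) + u * t_inner W (Y +\<^sub>T u \<cdot>\<^sub>T W)"
    using t_inner_commute[OF S Y] t_inner_commute[OF S W]
    by (simp add: t_inner_add_right[OF S Y uW] t_inner_smult_right[OF S W])
  then show ?thesis
    by (simp add: t_inner_add_right[OF Y Y uW] t_inner_smult_right[OF Y W]
        t_inner_add_right[OF W Y uW] t_inner_smult_right[OF W W]
        t_inner_commute[OF W Y] power2_eq_square algebra_simps)
qed

lemma t_minus_perturb:
  fixes Y Z W :: "'a :: comm_ring_1 tensor"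
  assumes Y: "Y \<in> tensor_carrier m n p" and Z: "Z \<in> tensor_carrier m n p"
    and W: "W \<in> tensor_carrier m n p"
  shows "Y -\<^sub>T (Z +\<^sub>T u \<cdot>\<^sub>T W) = (Y -\<^sub>T Z) +\<^sub>T (- u) \<cdot>\<^sub>T W"
proof (rule tensor_eqI)
  note uW = t_smult_carrier[OF W]
  note ZW = t_add_carrier[OF Z uW[of u]] and YZ = t_minus_carrier[OF Y Z]
  show "Y -\<^sub>T (Z +\<^sub>T u \<cdot>\<^sub>T W) \<in> tensor_carrier m n p" by (rule t_minus_carrier[OF Y ZW])
  show "(Y -\<^sub>T Z) +\<^sub>T (- u) \<cdot>\<^sub>T W \<in> tensor_carrier m n p" by (rule t_add_carrier[OF YZ uW])
  fix k i j assume "i < m" "j < n"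
  then show "t_entry (Y -\<^sub>T (Z +\<^sub>T u \<cdot>\<^sub>T W)) k i j = t_entry ((Y -\<^sub>T Z) +\<^sub>T (- u) \<cdot>\<^sub>T W) k i j"
    by (simp add: t_entry_minus[OF Y ZW] t_entry_add[OF Z uW] t_entry_smult[OF W]
        t_entry_add[OF YZ uW] t_entry_minus[OF Y Z])
qed

lemma t_concat_carrier:
  assumes A: "A \<in> tensor_carrier m n p" and B: "B \<in> tensor_carrier m s p"
  shows "t_concat A B \<in> tensor_carrier m (n + s) p"
proof (rule tensor_carrierI)
  show "length (t_concat A B) = p"
    by (simp add: t_concat_def tensor_carrierD(1)[OF A] tensor_carrierD(1)[OF B])
  fix k assume "k < p"
  then show "t_concat A B ! k \<in> carrier_mat m (n + s)"
    using carrier_matD[OF tensor_carrierD(2)[OF A, of k]] carrier_matD[OF tensor_carrierD(2)[OF B, of k]]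
    by (intro carrier_matI) (simp_all add: t_concat_def tensor_carrierD(1)[OF A] tensor_carrierD(1)[OF B])
qed

lemma t_entry_concat:
  assumes A: "A \<in> tensor_carrier m n p" and B: "B \<in> tensor_carrier m s p"
    and ij: "i < m" "j < n + s"
  shows "t_entry (t_concat A B) k i j = (if j < n then t_entry A k i j else t_entry B k i (j - n))"
  using ij carrier_matD[OF tensor_slice[OF A, of k]] carrier_matD[OF tensor_slice[OF B, of k]]
    slice_less[of k]
  by (simp add: t_entry_def t_concat_def tensor_carrierD(1)[OF A] tensor_carrierD(1)[OF B])

text \<open>The columns split into the first \<open>n\<close> and the last \<open>s\<close>, and the
  sum of squares splits with them.\<close>

lemma t_frob_concat_minus:
  assumes A: "A \<in> tensor_carrier m n p" and B: "B \<in> tensor_carrier m s p"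
    and C: "C \<in> tensor_carrier m n p" and D: "D \<in> tensor_carrier m s p"
  shows "(t_frob (t_concat A B -\<^sub>T t_concat C D))\<^sup>2 =
    t_inner (A -\<^sub>T C) (A -\<^sub>T C) + t_inner (B -\<^sub>T D) (B -\<^sub>T D)"
proof -
  note AB = t_concat_carrier[OF A B] and CD = t_concat_carrier[OF C D]
  note AC = t_minus_carrier[OF A C] and BD = t_minus_carrier[OF B D]
    and X = t_minus_carrier[OF AB CD]
  show ?thesis
    unfolding t_frob_square
    by (simp add: t_inner_entry[OF X X] t_inner_entry[OF AC AC]
      t_inner_entry[OF BD BD] sum_lessThan_add t_entry_minus[OF AB CD]
      t_entry_minus[OF A C] t_entry_minus[OF B D] t_entry_concat[OF A B]
      t_entry_concat[OF C D] sum.distrib)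
qed

text \<open>The residual is affine in \<open>At\<close> for fixed \<open>X\<close> and affine in
  \<open>X\<close> for fixed \<open>At\<close>, so each one-entry variation of the Lagrangian is
  quadratic. Its linear coefficient pairs the gradient with a basis tensor, after adjointness has
  freed that basis tensor from its product.\<close>

lemma lagrange_stationarity:
  assumes A: "A \<in> tensor_carrier m n p" and B: "B \<in> tensor_carrier m s p"
    and K: "K \<in> tensor_carrier q n p"
    and At: "At \<in> tensor_carrier m n p" and X: "X \<in> tensor_carrier n s p"
    and mult: "is_lagrange_multiplier A B K \<delta> At X \<mu>"
    and R_def: "R = B -\<^sub>T At *\<^sub>T X"
  shows "At = A +\<^sub>T R *\<^sub>T X\<^sup>\<top>"
    and "At\<^sup>\<top> *\<^sub>T R = \<mu> \<cdot>\<^sub>T (K\<^sup>\<top> *\<^sub>T (K *\<^sub>T X))"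
proof -
  note AtX = t_prod_carrier[OF At X] and KX = t_prod_carrier[OF K X]
  note Xt = t_transpose_carrier[OF X] and Kt = t_transpose_carrier[OF K]
    and Att = t_transpose_carrier[OF At]
  have R: "R \<in> tensor_carrier m s p" unfolding R_def by (rule t_minus_carrier[OF B AtX])
  note RX = t_prod_carrier[OF R Xt] and AR = t_prod_carrier[OF Att R]
    and KKX = t_prod_carrier[OF Kt KX] and AAt = t_minus_carrier[OF A At]
  have L: "tr_tls_lagrangian A B K \<delta> Y Z \<mu> = t_inner (A -\<^sub>T Y) (A -\<^sub>T Y) +
      t_inner (B -\<^sub>T Y *\<^sub>T Z) (B -\<^sub>T Y *\<^sub>T Z) + \<mu> * (t_inner (K *\<^sub>T Z) (K *\<^sub>T Z) - \<delta>\<^sup>2)"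
    if Y: "Y \<in> tensor_carrier m n p" and Z: "Z \<in> tensor_carrier n s p" for Y Z
    unfolding tr_tls_lagrangian_def t_frob_concat_minus[OF A B Y t_prod_carrier[OF Y Z]]
    by (simp add: t_frob_square)
  show "At = A +\<^sub>T R *\<^sub>T X\<^sup>\<top>"
  proof (rule tensor_eqI_nat[OF At t_add_carrier[OF A RX]])
    fix k i j assume kij: "k < p" "i < m" "j < n"
    let ?E = "t_unit m n i j k"
    note E = t_unit_carrier[of m n i j k, where ?'a = real]
    note EX = t_prod_carrier[OF E X]
    let ?L = "\<lambda>t. tr_tls_lagrangian A B K \<delta> (t_update At i j k t) X \<mu>"
    \<comment> \<open>Both \<open>A -\<^sub>T At\<close> and \<open>R\<close> move by -u times a
      fixed tensor, whence the factor -2; the constraint term does not involve \<open>At\<close> and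
      stays in the constant.\<close>
    have "?L t = (t_inner (A -\<^sub>T At) (A -\<^sub>T At) + t_inner R R + \<mu> * (t_inner (K *\<^sub>T X) (K *\<^sub>T X) - \<delta>\<^sup>2)) +
        (t - At ! k $$ (i, j)) * (- 2 * (t_inner (A -\<^sub>T At) ?E + t_inner R (?E *\<^sub>T X))) +
        (t - At ! k $$ (i, j))\<^sup>2 * (t_inner ?E ?E + t_inner (?E *\<^sub>T X) (?E *\<^sub>T X))" for t
    proof -
      let ?u = "t - At ! k $$ (i, j)"
      note uE = t_smult_carrier[OF E, of ?u]
      have "(At +\<^sub>T ?u \<cdot>\<^sub>T ?E) *\<^sub>T X = At *\<^sub>T X +\<^sub>T ?u \<cdot>\<^sub>T (?E *\<^sub>T X)"
        by (simp add: t_prod_add_left[OF At uE X] t_prod_smult_left[OF E X])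
      then have "B -\<^sub>T (At +\<^sub>T ?u \<cdot>\<^sub>T ?E) *\<^sub>T X = R +\<^sub>T (- ?u) \<cdot>\<^sub>T (?E *\<^sub>T X)"
        unfolding R_def using t_minus_perturb[OF B AtX EX] by simp
      then show ?thesis
        unfolding t_update_eq[OF At kij(1)] L[OF t_add_carrier[OF At uE] X]
          t_minus_perturb[OF A At E] t_inner_perturb[OF AAt E]
        by (simp only: t_inner_perturb[OF R EX] power2_minus) (simp add: algebra_simps)
    qed
    moreover have "(?L has_real_derivative 0) (at (At ! k $$ (i, j)))"
      using mult kij unfolding is_lagrange_multiplier_def partials_vanish_def tensor_dims[OF At]
      by blast
    ultimately have "- 2 * (t_inner (A -\<^sub>T At) ?E + t_inner R (?E *\<^sub>T X)) = 0"
      by (rule quadratic_stationary[rotated])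
    \<comment> \<open>Moving \<open>X\<close> to the other side of the pairing leaves the basis
      tensor alone, so the coefficient is an entry of \<open>A - At + R * X^T\<close>.\<close>
    then have "t_entry (A -\<^sub>T At) (int k) i j + t_entry (R *\<^sub>T X\<^sup>\<top>) (int k) i j = 0"
      using kij by (simp add: t_inner_unit[OF AAt] t_inner_unit[OF RX] t_inner_prod_right[OF E X R])
    then show "t_entry At (int k) i j = t_entry (A +\<^sub>T R *\<^sub>T X\<^sup>\<top>) (int k) i j"
      using kij by (simp add: t_entry_minus[OF A At] t_entry_add[OF A RX])
  qed
  show "At\<^sup>\<top> *\<^sub>T R = \<mu> \<cdot>\<^sub>T (K\<^sup>\<top> *\<^sub>T (K *\<^sub>T X))"
  proof (rule tensor_eqI_nat[OF AR t_smult_carrier[OF KKX]])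
    fix k i j assume kij: "k < p" "i < n" "j < s"
    let ?E = "t_unit n s i j k"
    note E = t_unit_carrier[of n s i j k, where ?'a = real]
    note AE = t_prod_carrier[OF At E] and KE = t_prod_carrier[OF K E]
    let ?L = "\<lambda>t. tr_tls_lagrangian A B K \<delta> At (t_update X i j k t) \<mu>"
    \<comment> \<open>Here the residual moves by -u and \<open>K *\<^sub>T X\<close> by +u, so the
      two linear terms carry opposite signs.\<close>
    have "?L t = (t_inner (A -\<^sub>T At) (A -\<^sub>T At) + t_inner R R + \<mu> * (t_inner (K *\<^sub>T X) (K *\<^sub>T X) - \<delta>\<^sup>2)) +
        (t - X ! k $$ (i, j)) * (2 * (\<mu> * t_inner (K *\<^sub>T X) (K *\<^sub>T ?E) - t_inner R (At *\<^sub>T ?E))) +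
        (t - X ! k $$ (i, j))\<^sup>2 * (t_inner (At *\<^sub>T ?E) (At *\<^sub>T ?E) + \<mu> * t_inner (K *\<^sub>T ?E) (K *\<^sub>T ?E))" for t
    proof -
      let ?u = "t - X ! k $$ (i, j)"
      note uE = t_smult_carrier[OF E, of ?u]
      have "At *\<^sub>T (X +\<^sub>T ?u \<cdot>\<^sub>T ?E) = At *\<^sub>T X +\<^sub>T ?u \<cdot>\<^sub>T (At *\<^sub>T ?E)"
        by (simp add: t_prod_add_right[OF At X uE] t_prod_smult_right[OF At E])
      then have 1: "B -\<^sub>T At *\<^sub>T (X +\<^sub>T ?u \<cdot>\<^sub>T ?E) = R +\<^sub>T (- ?u) \<cdot>\<^sub>T (At *\<^sub>T ?E)"
        unfolding R_def using t_minus_perturb[OF B AtX AE] by simp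
      have 2: "K *\<^sub>T (X +\<^sub>T ?u \<cdot>\<^sub>T ?E) = K *\<^sub>T X +\<^sub>T ?u \<cdot>\<^sub>T (K *\<^sub>T ?E)"
        by (simp add: t_prod_add_right[OF K X uE] t_prod_smult_right[OF K E])
      show ?thesis
        unfolding t_update_eq[OF X kij(1)] L[OF At t_add_carrier[OF X uE]] 1 2
          t_inner_perturb[OF KX KE] t_inner_perturb[OF R AE] power2_minus
        by (simp add: algebra_simps)
    qed
    moreover have "(?L has_real_derivative 0) (at (X ! k $$ (i, j)))"
      using mult kij unfolding is_lagrange_multiplier_def partials_vanish_def tensor_dims[OF X]
      by blast
    ultimately have "2 * (\<mu> * t_inner (K *\<^sub>T X) (K *\<^sub>T ?E) - t_inner R (At *\<^sub>T ?E)) = 0"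
      by (rule quadratic_stationary[rotated])
    then show "t_entry (At\<^sup>\<top> *\<^sub>T R) (int k) i j = t_entry (\<mu> \<cdot>\<^sub>T (K\<^sup>\<top> *\<^sub>T (K *\<^sub>T X))) (int k) i j"
      using kij by (simp add: t_inner_prod_left[OF K E KX] t_inner_prod_left[OF At E R]
          t_inner_unit[OF KKX] t_inner_unit[OF AR] t_entry_smult[OF KKX])
  qed
qed

subsection \<open>Fourier diagonalization and the Kronecker product with the identity\<close>

text \<open>The integer powers of the root of unity in \<open>dft_mat\<close>, so that conjugation is negation.\<close>

definition dft_root :: "int \<Rightarrow> complex" where
  "dft_root x = cis (- (2 * pi * of_int x / of_nat p))"

lemma dft_root_add: "dft_root (x + y) = dft_root x * dft_root y"
proof -
  have "- (2 * pi * of_int (x + y) / of_nat p) =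
      - (2 * pi * of_int x / of_nat p) + - (2 * pi * of_int y / of_nat p)"
    by (simp add: add_divide_distrib distrib_left)
  then show ?thesis by (simp only: dft_root_def cis_mult)
qed

lemma cnj_dft_root: "cnj (dft_root x) = dft_root (- x)"
  by (simp add: dft_root_def cis_cnj)

lemma dft_root_power: "dft_root x ^ n = dft_root (x * int n)"
proof (induction n)
  case 0
  show ?case by (simp add: dft_root_def)
next
  case (Suc n)
  then show ?case by (simp add: distrib_left dft_root_add)
qed

lemma dft_root_period: "dft_root (int p * x) = 1"
proof -
  have "- (2 * pi * of_int (int p * x) / of_nat p) = 2 * pi * of_int (- x)"
    using p_pos by simp
  then show ?thesis unfolding dft_root_def by (simp only: cis_multiple_2pi Ints_of_int)
qed

text \<open>Primitivity of the root. The real part is enough, since a cosine equals 1 only at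
  integer multiples of 2 pi.\<close>

lemma dft_root_eq_1:
  assumes "dft_root x = 1" shows "int p dvd x"
proof -
  have "cos (2 * pi * of_int x / of_nat p) = 1"
    using arg_cong[OF assms, of Re] by (simp add: dft_root_def)
  then obtain k :: int where "2 * pi * of_int x / of_nat p = of_int k * 2 * pi"
    using cos_one_2pi_int[THEN iffD1] by blast
  then have "real_of_int x = real_of_int (k * int p)" using p_pos by (simp add: field_simps)
  then have "x = k * int p" by (simp only: of_int_eq_iff)
  then show ?thesis by simp
qed

text \<open>Orthogonality of characters: if p does not divide x, this is a geometric sum whose ratio
  differs from 1 but has p-th power 1.\<close>

lemma sum_dft_root: "(\<Sum>a<p. dft_root (x * int a)) = (if int p dvd x then of_nat p else 0)"
proof (cases "int p dvd x")
  case True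
  then obtain y where "x = int p * y" by auto
  then have "dft_root (x * int a) = 1" for a using dft_root_period[of "y * int a"] by (simp add: mult.assoc)
  then show ?thesis using True by simp
next
  case False
  then have "dft_root x \<noteq> 1" using dft_root_eq_1 by blast
  moreover have "dft_root x ^ p = 1" using dft_root_period[of x] by (simp add: dft_root_power mult.commute)
  ultimately show ?thesis
    using False sum_gp_strict[of "dft_root x" p] by (simp add: dft_root_power)
qed

lemma dft_mat_index:
  assumes "k < p" "a < p"
  shows "dft_mat p $$ (k, a) = dft_root (int k * int a) / sqrt (real p)"
proof -
  have "exp (- (2 * pi * \<i>) / of_nat p) = dft_root 1"
    by (simp add: dft_root_def cis_conv_exp mult_ac)
  then show ?thesis
    using assms by (simp add: dft_mat_def dft_root_power)
qed

lemma mat_adjoint_dft_index: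
  assumes "a < p" "k < p"
  shows "mat_adjoint (dft_mat p) $$ (a, k) = dft_root (- (int k * int a)) / sqrt (real p)"
proof -
  have F: "dft_mat p \<in> carrier_mat p p" by (simp add: dft_mat_def)
  have "mat_adjoint (dft_mat p) $$ (a, k) = cnj (dft_mat p $$ (k, a))"
    using F assms by (simp add: mat_adjoint_def mat_of_rows_def)
  then show ?thesis using assms by (simp add: dft_mat_index cnj_dft_root)
qed

section \<open>Block Fourier matrices and their inversion\<close>

lemma block_fourier_carrier:
  assumes Ds: "Ds \<in> tensor_carrier m n p"
  shows "block_fourier m n Ds \<in> carrier_mat (m * p) (n * p)"
  by (rule carrier_matI)
    (simp_all add: block_fourier_def mat_kron_def dft_mat_def mat_adjoint_def tensor_carrierD(1)[OF Ds] mult.commute)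

text \<open>The identity factors in the Kronecker products preserve offsets within blocks, and the
  block diagonal matrix preserves the block index k, so only the sum over k survives. The two
  factors 1 / sqrt p combine to 1 / p: along the block difference this is an inverse discrete
  Fourier transform.\<close>

lemma block_fourier_index:
  assumes Ds: "Ds \<in> tensor_carrier m n p" and r: "r < m * p" and c: "c < n * p"
  shows "block_fourier m n Ds $$ (r, c) =
    (\<Sum>k<p. dft_root (int k * (int (c div n) - int (r div m))) * t_entry Ds (int k) (r mod m) (c mod n)) / of_nat p"
proof -
  let ?P = "mat_kron (mat_adjoint (dft_mat p)) (1\<^sub>m m)"
  let ?Q = "mat_kron (dft_mat p) (1\<^sub>m n)"
  let ?D = "diag_block_mat Ds"
  let ?s = "complex_of_real (sqrt (real p))"
  have len: "length Ds = p" and sub: "set Ds \<subseteq> carrier_mat m n" using Ds by (auto simp: tensor_carrier_def)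
  have P: "?P \<in> carrier_mat (m * p) (m * p)"
    by (simp add: mat_kron_def mat_adjoint_def dft_mat_def mult.commute)
  have Q: "?Q \<in> carrier_mat (n * p) (n * p)"
    by (simp add: mat_kron_def dft_mat_def mult.commute)
  have D: "?D \<in> carrier_mat (m * p) (n * p)" using diag_block_mat_carrier[OF sub] len by simp
  have PD: "?P * ?D \<in> carrier_mat (m * p) (n * p)" using P D by simp
  have dims: "dim_row (dft_mat p) = p" "dim_col (dft_mat p) = p"
    "dim_row (mat_adjoint (dft_mat p)) = p" "dim_col (mat_adjoint (dft_mat p)) = p"
    by (simp_all add: dft_mat_def mat_adjoint_def)
  have m: "0 < m" and n: "0 < n" using r c by (auto intro: Nat.gr0I)
  have div: "x div m < p" if "x < m * p" for x using that by (simp add: less_mult_imp_div_less mult.commute)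
  have div': "x div n < p" if "x < n * p" for x using that by (simp add: less_mult_imp_div_less mult.commute)
  have PD_index: "(?P * ?D) $$ (r, t) =
      dft_root (- (int (t div n) * int (r div m))) / ?s * t_entry Ds (int (t div n)) (r mod m) (t mod n)"
    if t: "t < n * p" for t
  proof -
    have "(?P * ?D) $$ (r, t) = (\<Sum>u<m * p. ?P $$ (r, u) * ?D $$ (u, t))"
      by (rule mult_mat_index_sum[OF P D r t])
    \<comment> \<open>A single u contributes: offset \<open>r mod m\<close> inside block
      \<open>t div n\<close>.\<close>
    also have "\<dots> = (\<Sum>u<m * p. if u mod m = r mod m then if u div m = t div n then
        dft_root (- (int (t div n) * int (r div m))) / ?s * t_entry Ds (int (t div n)) (r mod m) (t mod n) else 0 else 0)"
    proof (rule sum.cong[OF refl])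
      fix u assume "u \<in> {..<m * p}"
      then have u: "u < m * p" by simp
      have "?P $$ (r, u) = dft_root (- (int (u div m) * int (r div m))) / ?s * (if r mod m = u mod m then 1 else 0)"
        using r u m div[OF r] div[OF u]
        by (simp add: mat_kron_def mat_adjoint_dft_index mult.commute dims)
      moreover have "?D $$ (u, t) = (if u div m = t div n then t_entry Ds (int (t div n)) (u mod m) (t mod n) else 0)"
        using diag_block_mat_index[OF sub, of u t] u t div'[OF t] by (simp add: len t_entry_nth)
      ultimately show "?P $$ (r, u) * ?D $$ (u, t) = (if u mod m = r mod m then if u div m = t div n then
        dft_root (- (int (t div n) * int (r div m))) / ?s * t_entry Ds (int (t div n)) (r mod m) (t mod n) else 0 else 0)"
        by simp
    qed
    also have "\<dots> = (\<Sum>l<p. \<Sum>s<m. if s = r mod m then if l = t div n then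
        dft_root (- (int (t div n) * int (r div m))) / ?s * t_entry Ds (int (t div n)) (r mod m) (t mod n) else 0 else 0)"
      by (rule sum_div_mod)
    also have "\<dots> = dft_root (- (int (t div n) * int (r div m))) / ?s * t_entry Ds (int (t div n)) (r mod m) (t mod n)"
      using m div'[OF t] by simp
    finally show ?thesis .
  qed
  have "block_fourier m n Ds $$ (r, c) = (\<Sum>t<n * p. (?P * ?D) $$ (r, t) * ?Q $$ (t, c))"
    unfolding block_fourier_def len by (rule mult_mat_index_sum[OF PD Q r c])
  also have "\<dots> = (\<Sum>t<n * p. if t mod n = c mod n then
      dft_root (int (t div n) * (int (c div n) - int (r div m))) * t_entry Ds (int (t div n)) (r mod m) (c mod n) / of_nat p else 0)"
  proof (rule sum.cong[OF refl])
    fix t assume "t \<in> {..<n * p}"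
    then have t: "t < n * p" by simp
    have Qi: "?Q $$ (t, c) = dft_root (int (t div n) * int (c div n)) / ?s * (if t mod n = c mod n then 1 else 0)"
      using c t n div'[OF c] div'[OF t] by (simp add: mat_kron_def dft_mat_index mult.commute dims)
    have ss: "?s * ?s = of_nat p" by (metis of_nat_0_le_iff of_real_mult of_real_of_nat_eq real_sqrt_mult_self abs_of_nonneg)
    have rt: "dft_root (int (t div n) * (int (c div n) - int (r div m))) =
        dft_root (- (int (t div n) * int (r div m))) * dft_root (int (t div n) * int (c div n))"
      by (simp add: dft_root_add[symmetric] algebra_simps)
    show "(?P * ?D) $$ (r, t) * ?Q $$ (t, c) = (if t mod n = c mod n then
      dft_root (int (t div n) * (int (c div n) - int (r div m))) * t_entry Ds (int (t div n)) (r mod m) (c mod n) / of_nat p else 0)"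
      unfolding PD_index[OF t] Qi rt ss[symmetric] by simp
  qed
  also have "\<dots> = (\<Sum>l<p. \<Sum>s<n. if s = c mod n then
      dft_root (int l * (int (c div n) - int (r div m))) * t_entry Ds (int l) (r mod m) (c mod n) / of_nat p else 0)"
    by (rule sum_div_mod)
  also have "\<dots> = (\<Sum>k<p. dft_root (int k * (int (c div n) - int (r div m))) * t_entry Ds (int k) (r mod m) (c mod n)) / of_nat p"
    using n by (simp add: sum_divide_distrib)
  finally show ?thesis .
qed

text \<open>The first block column already recovers the blocks, by orthogonality of the roots. This
  supplies the uniqueness behind \<open>diag_blocks\<close>.\<close>

lemma block_fourier_inverse:
  assumes Ds: "Ds \<in> tensor_carrier m n p" and k: "k < p" and i: "i < m" and j: "j < n"
  shows "t_entry Ds (int k) i j = (\<Sum>a<p. dft_root (int k * int a) * block_fourier m n Ds $$ (a * m + i, j))"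
proof -
  have bf: "block_fourier m n Ds $$ (a * m + i, j) =
      (\<Sum>l<p. dft_root (- (int l * int a)) * t_entry Ds (int l) i j) / of_nat p" if a: "a < p" for a
    using block_fourier_index[OF Ds block_index(1)[OF a i], of j] block_index[OF a i] block_index[OF p_pos j] j
    by simp
  have rt: "dft_root ((int k - int l) * int a) = dft_root (int k * int a) * dft_root (- (int l * int a))" for l a
    by (simp add: dft_root_add[symmetric] algebra_simps)
  have "(\<Sum>a<p. dft_root (int k * int a) * block_fourier m n Ds $$ (a * m + i, j)) =
      (\<Sum>a<p. \<Sum>l<p. dft_root ((int k - int l) * int a) * t_entry Ds (int l) i j / of_nat p)"
    by (intro sum.cong refl) (simp add: bf rt sum_distrib_left sum_divide_distrib mult.assoc)
  also have "\<dots> = (\<Sum>l<p. (\<Sum>a<p. dft_root ((int k - int l) * int a)) * t_entry Ds (int l) i j / of_nat p)"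
    by (subst sum.swap) (simp add: sum_distrib_right sum_divide_distrib)
  also have "\<dots> = (\<Sum>l<p. if l = k then t_entry Ds (int k) i j else 0)"
  proof (intro sum.cong refl)
    fix l assume "l \<in> {..<p}"
    \<comment> \<open>Two indices below p differ by less than p in absolute value.\<close>
    then have "int p dvd int k - int l \<longleftrightarrow> l = k"
      using k by (auto simp: mod_eq_dvd_iff[symmetric])
    then show "(\<Sum>a<p. dft_root ((int k - int l) * int a)) * t_entry Ds (int l) i j / of_nat p =
        (if l = k then t_entry Ds (int k) i j else 0)"
      using p_pos by (simp add: sum_dft_root)
  qed
  finally show ?thesis using k by simp
qed

text \<open>The unnormalized discrete Fourier transform along the third mode; the compensating 1 / p
  arises inside \<open>block_fourier\<close>.\<close>

definition t_dft :: "nat \<Rightarrow> nat \<Rightarrow> real tensor \<Rightarrow> complex mat list" where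
  "t_dft m n A = map (\<lambda>k. mat m n (\<lambda>(i, j). \<Sum>l<p. dft_root (int k * int l) * of_real (t_entry A (int l) i j))) [0..<p]"

lemma t_dft_carrier: "t_dft m n A \<in> tensor_carrier m n p"
  by (auto intro!: tensor_carrierI simp: t_dft_def)

lemma t_entry_dft:
  "k < p \<Longrightarrow> i < m \<Longrightarrow> j < n \<Longrightarrow> t_entry (t_dft m n A) (int k) i j =
    (\<Sum>l<p. dft_root (int k * int l) * of_real (t_entry A (int l) i j))"
  by (simp add: t_entry_nth t_dft_def)

text \<open>After exchanging the sums, orthogonality keeps the one slice l congruent to row block
  minus column block, which is the slice that \<open>bcirc\<close> places there.\<close>

lemma block_fourier_dft:
  assumes A: "A \<in> tensor_carrier m n p"
  shows "block_fourier m n (t_dft m n A) = map_mat complex_of_real (bcirc A)"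
proof (rule eq_matI)
  note bA = bcirc_carrier[OF A] and bf = block_fourier_carrier[OF t_dft_carrier[of m n A]]
  show "dim_row (block_fourier m n (t_dft m n A)) = dim_row (map_mat complex_of_real (bcirc A))"
    "dim_col (block_fourier m n (t_dft m n A)) = dim_col (map_mat complex_of_real (bcirc A))"
    using bA bf by auto
  fix r c assume "r < dim_row (map_mat complex_of_real (bcirc A))" "c < dim_col (map_mat complex_of_real (bcirc A))"
  then have r: "r < m * p" and c: "c < n * p" using bA by auto
  have mn: "r mod m < m" "c mod n < n" using r c by (auto intro!: mod_less_divisor Nat.gr0I)
  let ?x = "int (c div n) - int (r div m)"
  let ?e = "\<lambda>l. complex_of_real (t_entry A l (r mod m) (c mod n))"
  have "block_fourier m n (t_dft m n A) $$ (r, c) =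
      (\<Sum>k<p. \<Sum>l<p. dft_root ((?x + int l) * int k) * ?e (int l)) / of_nat p"
    using mn
    by (simp add: block_fourier_index[OF t_dft_carrier r c] t_entry_dft sum_distrib_left mult.assoc[symmetric]
       dft_root_add[symmetric] algebra_simps)
  also have "\<dots> = (\<Sum>l<p. (\<Sum>k<p. dft_root ((?x + int l) * int k)) * ?e (int l)) / of_nat p"
    by (subst sum.swap) (simp add: sum_distrib_right)
  also have "\<dots> = (\<Sum>l<p. if int p dvd ?x + int l then ?e (int l) else 0)"
    unfolding sum_divide_distrib using p_pos by (intro sum.cong refl) (simp add: sum_dft_root)
  also have "\<dots> = (\<Sum>l<p. if l = nat (- ?x mod int p) then ?e (- ?x) else 0)"
  proof (intro sum.cong refl)
    fix l assume "l \<in> {..<p}"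
    then have l: "l < p" by simp
    have iff: "int p dvd ?x + int l \<longleftrightarrow> int l mod int p = - ?x mod int p"
      by (simp add: mod_eq_dvd_iff algebra_simps)
    also have "\<dots> \<longleftrightarrow> l = nat (- ?x mod int p)" using l p_pos by auto
    finally have iff': "int p dvd ?x + int l \<longleftrightarrow> l = nat (- ?x mod int p)" .
    show "(if int p dvd ?x + int l then ?e (int l) else 0) = (if l = nat (- ?x mod int p) then ?e (- ?x) else 0)"
    proof (cases "int p dvd ?x + int l")
      case True
      then have "?e (int l) = ?e (- ?x)" using iff t_entry_congr[OF A] by metis
      then show ?thesis using True iff' by simp
    qed (use iff' in simp)
  qed
  also have "\<dots> = ?e (- ?x)" using slice_less[of "- ?x"] by simp
  also have "\<dots> = map_mat complex_of_real (bcirc A) $$ (r, c)"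
    using bcirc_index[OF A r c] bA r c by simp
  finally show "block_fourier m n (t_dft m n A) $$ (r, c) = map_mat complex_of_real (bcirc A) $$ (r, c)" .
qed

text \<open>Existence of the diagonalization comes from \<open>block_fourier_dft\<close>, uniqueness
  from reading any other block list back with \<open>block_fourier_inverse\<close>.\<close>

lemma diag_blocks_eq_dft:
  assumes A: "A \<in> tensor_carrier m n p"
  shows "diag_blocks A = t_dft m n A"
  unfolding diag_blocks_def tensor_dims[OF A]
proof (rule the_equality)
  show "t_dft m n A \<in> tensor_carrier m n p \<and> map_mat complex_of_real (bcirc A) = block_fourier m n (t_dft m n A)"
    using t_dft_carrier block_fourier_dft[OF A] by simp
  fix Ds assume Ds: "Ds \<in> tensor_carrier m n p \<and> map_mat complex_of_real (bcirc A) = block_fourier m n Ds"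
  show "Ds = t_dft m n A"
    using Ds by (intro tensor_eqI_nat[OF _ t_dft_carrier])
      (auto simp: block_fourier_inverse[of Ds] block_fourier_inverse[OF t_dft_carrier] block_fourier_dft[OF A])
qed

text \<open>The first block column of a block circulant lists all slices, so \<open>bcirc\<close> is
  injective; the sizes come back on dividing the dimensions by p > 0.\<close>

lemma bcirc_inv_bcirc:
  assumes T: "T \<in> tensor_carrier m n p"
  shows "bcirc_inv p (map_mat complex_of_real (bcirc T)) = T"
  unfolding bcirc_inv_def
proof (rule the_equality)
  have dims: "dim_row (map_mat complex_of_real (bcirc T)) div p = m"
    "dim_col (map_mat complex_of_real (bcirc T)) div p = n"
    using bcirc_carrier[OF T] p_pos by auto
  show "T \<in> tensor_carrier (dim_row (map_mat complex_of_real (bcirc T)) div p)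
      (dim_col (map_mat complex_of_real (bcirc T)) div p) p \<and>
    map_mat complex_of_real (bcirc T) = map_mat complex_of_real (bcirc T)"
    unfolding dims using T by simp
  fix S assume "S \<in> tensor_carrier (dim_row (map_mat complex_of_real (bcirc T)) div p)
      (dim_col (map_mat complex_of_real (bcirc T)) div p) p \<and>
    map_mat complex_of_real (bcirc S) = map_mat complex_of_real (bcirc T)"
  then have S: "S \<in> tensor_carrier m n p"
    and eq: "map_mat complex_of_real (bcirc S) = map_mat complex_of_real (bcirc T)"
    unfolding dims by auto
  show "S = T"
  proof (rule tensor_eqI_nat[OF S T])
    fix l i j assume l: "l < p" and i: "i < m" and j: "j < n"
    have 0: "j < n * p" using block_index(1)[OF p_pos j] by simp
    have "bcirc S $$ (l * m + i, j) = bcirc T $$ (l * m + i, j)"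
      using arg_cong[OF eq, of "\<lambda>M. M $$ (l * m + i, j)"] block_index(1)[OF l i] 0
        bcirc_carrier[OF S] bcirc_carrier[OF T] by auto
    then show "t_entry S (int l) i j = t_entry T (int l) i j"
      using bcirc_index[OF S block_index(1)[OF l i] 0] bcirc_index[OF T block_index(1)[OF l i] 0]
        block_index(2,3)[OF l i] j by simp
  qed
qed

section \<open>Kronecker product of a tube with the identity\<close>

definition tube_diag :: "nat \<Rightarrow> real tensor \<Rightarrow> real tensor" where
  "tube_diag n lam = map (\<lambda>k. mat n n (\<lambda>(i, j). if i = j then t_entry lam (int k) 0 0 else 0)) [0..<p]"

lemma tube_diag_carrier: "tube_diag n lam \<in> tensor_carrier n n p"
  by (auto intro!: tensor_carrierI simp: tube_diag_def)

lemma t_entry_tube_diag: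
  assumes lam: "lam \<in> tensor_carrier 1 1 p" and ij: "i < n" "j < n"
  shows "t_entry (tube_diag n lam) k i j = (if i = j then t_entry lam k 0 0 else 0)"
proof -
  have "t_entry (tube_diag n lam) k i j = (if i = j then t_entry lam (k mod int p) 0 0 else 0)"
    using ij p_pos slice_less[of k]
    by (simp add: t_entry_def[of "tube_diag n lam"] tensor_carrierD(1)[OF tube_diag_carrier])
      (simp add: tube_diag_def)
  then show ?thesis by (simp add: t_entry_mod[OF lam])
qed

text \<open>The identity tensor is a delta in the slice index, so every Fourier block of it is the
  identity matrix. The Kronecker blocks are therefore scalar matrices holding the transform of
  \<open>lam\<close>, and these are the blocks of \<open>tube_diag n lam\<close>.\<close>

lemma t_kron_id:
  assumes lam: "lam \<in> tensor_carrier 1 1 p"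
  shows "lam \<otimes>\<^sub>T t_id n p = tube_diag n lam"
proof -
  note I = t_id_carrier[of n, where ?'a = real]
  let ?Ds = "map2 mat_kron (t_dft 1 1 lam) (t_dft n n (t_id n p))"
  have D1: "t_dft n n (t_id n p) ! k = 1\<^sub>m n" if k: "k < p" for k
  proof (rule eq_matI)
    fix i j assume "i < dim_row (1\<^sub>m n)" "j < dim_col (1\<^sub>m n)"
    then have ij: "i < n" "j < n" by auto
    have "t_entry (t_dft n n (t_id n p)) (int k) i j = (\<Sum>l<p. if l = 0 then if i = j then 1 else 0 else 0)"
      unfolding t_entry_dft[OF k ij]
    proof (intro sum.cong refl)
      fix l assume "l \<in> {..<p}"
      then have "int p dvd int l \<longleftrightarrow> l = 0" by (auto dest: nat_dvd_not_less)
      then show "dft_root (int k * int l) * complex_of_real (t_entry (t_id n p) (int l) i j) =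
          (if l = 0 then if i = j then 1 else 0 else 0)"
        using ij by (auto simp: t_entry_id dft_root_def)
    qed
    then show "t_dft n n (t_id n p) ! k $$ (i, j) = 1\<^sub>m n $$ (i, j)"
      using k ij p_pos by (simp add: t_entry_nth tensor_carrierD(1)[OF t_dft_carrier])
  qed (use tensor_carrierD(2)[OF t_dft_carrier k, of n n "t_id n p"] in auto)
  have "?Ds = t_dft n n (tube_diag n lam)"
  proof (rule nth_equalityI)
    show "length ?Ds = length (t_dft n n (tube_diag n lam))" by (simp add: t_dft_def)
    fix k assume "k < length ?Ds"
    then have k: "k < p" by (simp add: t_dft_def)
    note C = tensor_carrierD(2)[OF t_dft_carrier k]
    have Dk: "?Ds ! k = mat_kron (t_dft 1 1 lam ! k) (1\<^sub>m n)"
      using k D1[OF k] by (simp add: tensor_carrierD(1)[OF t_dft_carrier])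
    show "?Ds ! k = t_dft n n (tube_diag n lam) ! k"
      unfolding Dk
    proof (rule eq_matI)
      fix i j assume "i < dim_row (t_dft n n (tube_diag n lam) ! k)" "j < dim_col (t_dft n n (tube_diag n lam) ! k)"
      then have ij: "i < n" "j < n" using C[of n n "tube_diag n lam"] by auto
      have "mat_kron (t_dft 1 1 lam ! k) (1\<^sub>m n) $$ (i, j) = t_entry (t_dft 1 1 lam) (int k) 0 0 * (if i = j then 1 else 0)"
        using ij k carrier_matD[OF C[of 1 1 lam]] by (simp add: mat_kron_def t_entry_nth tensor_carrierD(1)[OF t_dft_carrier])
      also have "\<dots> = t_entry (t_dft n n (tube_diag n lam)) (int k) i j"
        using ij k by (simp add: t_entry_dft t_entry_tube_diag[OF lam])
      finally show "mat_kron (t_dft 1 1 lam ! k) (1\<^sub>m n) $$ (i, j) = t_dft n n (tube_diag n lam) ! k $$ (i, j)"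
        using k by (simp add: t_entry_nth tensor_carrierD(1)[OF t_dft_carrier])
    qed (use C[of 1 1 lam] C[of n n "tube_diag n lam"] in \<open>auto simp: mat_kron_def\<close>)
  qed
  then show ?thesis
    unfolding t_kron_def tensor_dims[OF lam] tensor_dims[OF I]
      diag_blocks_eq_dft[OF lam] diag_blocks_eq_dft[OF I]
    by (simp add: block_fourier_dft[OF tube_diag_carrier] bcirc_inv_bcirc[OF tube_diag_carrier])
qed

text \<open>Only h = i survives, leaving a scalar convolution in each row. The tube ends up on the
  right because \<open>X\<close> has a single column, where a 1 x 1 factor fits.\<close>

lemma tube_diag_prod:
  assumes lam: "lam \<in> tensor_carrier 1 1 p" and X: "X \<in> tensor_carrier n 1 p"
  shows "tube_diag n lam *\<^sub>T X = X *\<^sub>T lam"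
proof (rule tensor_eqI)
  note D = tube_diag_carrier[of n lam]
  show "tube_diag n lam *\<^sub>T X \<in> tensor_carrier n 1 p" "X *\<^sub>T lam \<in> tensor_carrier n 1 p"
    using t_prod_carrier[OF D X] t_prod_carrier[OF X lam] .
  fix k and i j :: nat assume i: "i < n" and j: "j < 1"
  have "t_entry (tube_diag n lam *\<^sub>T X) k i j =
      (\<Sum>l<p. \<Sum>h<n. if h = i then t_entry lam (k - int l) 0 0 * t_entry X (int l) i 0 else 0)"
    unfolding t_entry_prod[OF D X i j]
    using i j by (intro sum.cong refl) (auto simp: t_entry_tube_diag[OF lam])
  then show "t_entry (tube_diag n lam *\<^sub>T X) k i j = t_entry (X *\<^sub>T lam) k i j"
    using i j by (simp add: t_entry_prod_flip[OF X lam] mult.commute)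
qed

end

subsection \<open>Optimality conditions for TR-TLS\<close>

theorem theorem3p4:
  fixes m n p q :: nat
    and A B K At Bt X R lI lK :: "real tensor"
    and \<delta> \<mu> :: real
  assumes "m > 0" "n > 0" "p > 0" "q > 0"
    and "A \<in> tensor_carrier m n p"
    and "B \<in> tensor_carrier m 1 p"
    and "K \<in> tensor_carrier q n p"
    and "tr_tls_solution A B K \<delta> At Bt X"
    and "t_frob (K *\<^sub>T X) = \<delta>"
    and "is_lagrange_multiplier A B K \<delta> At X \<mu>"
    and "R = B -\<^sub>T At *\<^sub>T X"
    and "lI = \<mu> \<cdot>\<^sub>T (X\<^sup>\<top> *\<^sub>T K\<^sup>\<top> *\<^sub>T K *\<^sub>T X) -\<^sub>T R\<^sup>\<top> *\<^sub>T R *\<^sub>T X\<^sup>\<top> *\<^sub>T X -\<^sub>T R\<^sup>\<top> *\<^sub>T B"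
    and "lK = \<mu> \<cdot>\<^sub>T (t_id 1 p +\<^sub>T X\<^sup>\<top> *\<^sub>T X)"
  shows "(A\<^sup>\<top> *\<^sub>T A +\<^sub>T lI \<otimes>\<^sub>T t_id n p +\<^sub>T K\<^sup>\<top> *\<^sub>T K *\<^sub>T (lK \<otimes>\<^sub>T t_id n p)) *\<^sub>T X = A\<^sup>\<top> *\<^sub>T B
    \<and> B\<^sup>\<top> *\<^sub>T R -\<^sub>T R\<^sup>\<top> *\<^sub>T R = \<mu> \<cdot>\<^sub>T (X\<^sup>\<top> *\<^sub>T K\<^sup>\<top> *\<^sub>T K *\<^sub>T X)
    \<and> t_invertible (t_id 1 p +\<^sub>T X\<^sup>\<top> *\<^sub>T X)
    \<and> R = (B -\<^sub>T A *\<^sub>T X) *\<^sub>T t_inverse (t_id 1 p +\<^sub>T X\<^sup>\<top> *\<^sub>T X)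
    \<and> lK *\<^sub>T X\<^sup>\<top> *\<^sub>T K\<^sup>\<top> *\<^sub>T K *\<^sub>T X = B\<^sup>\<top> *\<^sub>T (B -\<^sub>T A *\<^sub>T X) +\<^sub>T lI"
proof -
  note p = assms(3) and A = assms(5) and B = assms(6) and K = assms(7) and R_def = assms(11)
  note dims = tensor_dims[OF p A] tensor_dims[OF p B]
  have At: "At \<in> tensor_carrier m n p" and X: "X \<in> tensor_carrier n 1 p"
    using assms(8) unfolding tr_tls_solution_def tr_tls_feasible_def dims by auto
  define s where "s = t_id 1 p +\<^sub>T X\<^sup>\<top> *\<^sub>T X"
  define G where "G = R\<^sup>\<top> *\<^sub>T R"
  define Y where "Y = K\<^sup>\<top> *\<^sub>T (K *\<^sub>T X)"
  define P where "P = X\<^sup>\<top> *\<^sub>T Y"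
  note c = t_prod_carrier[OF p] and tr = t_transpose_carrier[OF p]
  note AtX = c[OF At X] and AX = c[OF A X] and AT = tr[OF A] and BT = tr[OF B] and XT = tr[OF X]
    and KT = tr[OF K] and AtT = tr[OF At] and KX = c[OF K X] and I = t_id_carrier[OF p, of 1, where ?'a = real]
  have R: "R \<in> tensor_carrier m 1 p" unfolding R_def by (rule t_minus_carrier[OF p B AtX])
  note RT = tr[OF R]
  have G: "G \<in> tensor_carrier 1 1 p" unfolding G_def by (rule c[OF RT R])
  have Y: "Y \<in> tensor_carrier n 1 p" unfolding Y_def by (rule c[OF KT KX])
  have P: "P \<in> tensor_carrier 1 1 p" unfolding P_def by (rule c[OF XT Y])
  note XX = c[OF XT X] and BR = c[OF BT R] and RB = c[OF RT B]
  have s: "s \<in> tensor_carrier 1 1 p" unfolding s_def by (rule t_add_carrier[OF p I XX])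
  note Gs = c[OF G s] and Ps = c[OF P s] and muP = t_smult_carrier[OF p P, of \<mu>]
    and mus = t_smult_carrier[OF p s, of \<mu>] and RX = c[OF R XT] and BAX = t_minus_carrier[OF p B AX]
    and XG = c[OF X G] and AtTR = c[OF AT R] and GXX = c[OF G XX] and AB = c[OF AT B]
    and AAX = c[OF AT AX] and ABAX = c[OF AT BAX] and BBAX = c[OF BT BAX] and XGs = c[OF X Gs]
    and Ys = c[OF Y s] and AA = c[OF AT A]
  note muYs = t_smult_carrier[OF p Ys, of \<mu>]
  have At_eq: "At = A +\<^sub>T R *\<^sub>T X\<^sup>\<top>" and stat: "At\<^sup>\<top> *\<^sub>T R = \<mu> \<cdot>\<^sub>T Y"
    using lagrange_stationarity[OF p A B K At X assms(10) R_def] unfolding Y_def by auto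
  \<comment> \<open>The statement nests products to the left, while stationarity yields
    \<open>Y\<close> nested to the right.\<close>
  have XKKX: "X\<^sup>\<top> *\<^sub>T K\<^sup>\<top> *\<^sub>T K *\<^sub>T X = P"
    unfolding P_def Y_def
    by (simp only: t_prod_assoc[OF p c[OF XT KT] K X] t_prod_assoc[OF p XT KT KX])
  have AtX_eq: "At *\<^sub>T X = B -\<^sub>T R"
    by (rule tensor_eqI[OF p AtX t_minus_carrier[OF p B R]])
      (simp add: t_entry_minus[OF p B R] t_entry_minus[OF p B AtX, folded R_def])
  have "\<mu> \<cdot>\<^sub>T P = X\<^sup>\<top> *\<^sub>T (At\<^sup>\<top> *\<^sub>T R)"
    unfolding stat P_def by (simp only: t_prod_smult_right[OF p XT Y])
  also have "\<dots> = (At *\<^sub>T X)\<^sup>\<top> *\<^sub>T R"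
    by (simp only: t_transpose_prod[OF p At X] t_prod_assoc[OF p XT AtT R])
  also have "\<dots> = B\<^sup>\<top> *\<^sub>T R -\<^sub>T G"
    unfolding AtX_eq t_transpose_minus[OF p B R] G_def by (rule t_prod_minus_left[OF p BT RT R])
  finally have muP_eq: "\<mu> \<cdot>\<^sub>T P = B\<^sup>\<top> *\<^sub>T R -\<^sub>T G" .
  \<comment> \<open>\<open>G\<close> and \<open>P\<close> are Gram tubes, of \<open>R\<close> and of
    \<open>K *\<^sub>T X\<close>, hence symmetric; the combination of them in \<open>BR_eq\<close>
    then is too.\<close>
  have GT: "G\<^sup>\<top> = G"
    unfolding G_def by (simp only: t_transpose_prod[OF p RT R] t_transpose_transpose[OF p R])
  have PT: "P\<^sup>\<top> = P"
    unfolding P_def Y_def t_prod_assoc[OF p XT KT KX, symmetric] t_transpose_prod[OF p K X, symmetric]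
    by (simp only: t_transpose_prod[OF p tr[OF KX] KX] t_transpose_transpose[OF p KX])
  have BR_eq: "B\<^sup>\<top> *\<^sub>T R = \<mu> \<cdot>\<^sub>T P +\<^sub>T G"
    unfolding muP_eq
    by (rule tensor_eqI[OF p BR t_add_carrier[OF p t_minus_carrier[OF p BR G] G]])
      (simp add: t_entry_add[OF p t_minus_carrier[OF p BR G] G] t_entry_minus[OF p BR G])
  have "R\<^sup>\<top> *\<^sub>T B = (B\<^sup>\<top> *\<^sub>T R)\<^sup>\<top>"
    by (simp only: t_transpose_prod[OF p BT R] t_transpose_transpose[OF p B])
  then have RB_eq: "R\<^sup>\<top> *\<^sub>T B = B\<^sup>\<top> *\<^sub>T R"
    unfolding BR_eq by (simp only: t_transpose_add[OF p muP G] t_transpose_smult[OF p P] GT PT)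
  have "At *\<^sub>T X = A *\<^sub>T X +\<^sub>T R *\<^sub>T (X\<^sup>\<top> *\<^sub>T X)"
    unfolding At_eq by (simp only: t_prod_add_left[OF p A RX X] t_prod_assoc[OF p R XT X])
  note AtX_eq' = this
  \<comment> \<open>Two expressions for \<open>At *\<^sub>T X\<close> are compared: B - R from the
    residual and A * X + R * X^T * X from stationarity.\<close>
  have Rs: "R *\<^sub>T s = B -\<^sub>T A *\<^sub>T X"
  proof (rule tensor_eqI[OF p c[OF R s] BAX])
    fix k and i j :: nat assume ij: "i < m" "j < 1"
    have "R *\<^sub>T s = R +\<^sub>T R *\<^sub>T (X\<^sup>\<top> *\<^sub>T X)"
      unfolding s_def by (simp only: t_prod_add_right[OF p R I XX] t_prod_id_right[OF p R])
    moreover have "t_entry (At *\<^sub>T X) k i j = t_entry B k i j - t_entry R k i j"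
      unfolding AtX_eq by (rule t_entry_minus[OF p B R ij])
    ultimately show "t_entry (R *\<^sub>T s) k i j = t_entry (B -\<^sub>T A *\<^sub>T X) k i j"
      unfolding AtX_eq' t_entry_add[OF p AX c[OF R XX] ij]
      by (simp add: t_entry_add[OF p R c[OF R XX] ij] t_entry_minus[OF p B AX ij])
  qed
  have inv: "t_invertible s" unfolding s_def by (rule t_invertible_id_plus_gram[OF p X])
  then obtain D where D: "is_t_inverse s D" unfolding t_invertible_def by blast
  note D' = D[unfolded is_t_inverse_def tensor_dims[OF p s]]
  have R_eq: "R = (B -\<^sub>T A *\<^sub>T X) *\<^sub>T t_inverse s"
  proof -
    have "(B -\<^sub>T A *\<^sub>T X) *\<^sub>T D = R *\<^sub>T (s *\<^sub>T D)"
      unfolding Rs[symmetric] by (rule t_prod_assoc[OF p R s D'[THEN conjunct1]])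
    also have "\<dots> = R" using D' by (simp only: t_prod_id_right[OF p R])
    finally show ?thesis unfolding t_inverse_eqI[OF p s D] ..
  qed
  have lI: "lI \<in> tensor_carrier 1 1 p" and lI_entry: "t_entry lI k 0 0 = - t_entry (G *\<^sub>T s) k 0 0" for k
  proof -
    have assoc: "R\<^sup>\<top> *\<^sub>T R *\<^sub>T X\<^sup>\<top> *\<^sub>T X = G *\<^sub>T (X\<^sup>\<top> *\<^sub>T X)"
      unfolding G_def by (rule t_prod_assoc[OF p c[OF RT R] XT X])
    \<comment> \<open>The multiplier equation replaces mu P, and symmetry replaces R^T * B. The two
      copies of B^T * R then cancel, leaving -(G + G * X^T * X).\<close>
    have lI_eq: "lI = (B\<^sup>\<top> *\<^sub>T R -\<^sub>T G) -\<^sub>T G *\<^sub>T (X\<^sup>\<top> *\<^sub>T X) -\<^sub>T B\<^sup>\<top> *\<^sub>T R"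
      unfolding assms(12) XKKX assoc RB_eq muP_eq ..
    note c1 = t_minus_carrier[OF p BR G]
    note c2 = t_minus_carrier[OF p c1 GXX]
    show "lI \<in> tensor_carrier 1 1 p" unfolding lI_eq by (rule t_minus_carrier[OF p c2 BR])
    have "G *\<^sub>T s = G +\<^sub>T G *\<^sub>T (X\<^sup>\<top> *\<^sub>T X)"
      unfolding s_def by (simp only: t_prod_add_right[OF p G I XX] t_prod_id_right[OF p G])
    then show "t_entry lI k 0 0 = - t_entry (G *\<^sub>T s) k 0 0"
      unfolding lI_eq by (simp add: t_entry_minus[OF p c2 BR] t_entry_minus[OF p c1 GXX]
          t_entry_minus[OF p BR G] t_entry_add[OF p G GXX])
  qed
  have lI_eq: "lI = (- 1) \<cdot>\<^sub>T (G *\<^sub>T s)"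
    by (rule tensor_eqI[OF p lI t_smult_carrier[OF p Gs]])
      (simp add: lI_entry t_entry_smult[OF p Gs])
  have lK_eq: "lK = \<mu> \<cdot>\<^sub>T s" unfolding assms(13) s_def ..
  have lK: "lK \<in> tensor_carrier 1 1 p" unfolding lK_eq by (rule mus)
  \<comment> \<open>In \<open>At^T * R * s\<close> the factor \<open>R * s\<close> next to
    \<open>A^T\<close> becomes \<open>B - A * X\<close>, while the part with \<open>X * R^T\<close>
    gives \<open>X * G * s\<close>.\<close>
  have adj: "A\<^sup>\<top> *\<^sub>T (B -\<^sub>T A *\<^sub>T X) +\<^sub>T X *\<^sub>T (G *\<^sub>T s) = \<mu> \<cdot>\<^sub>T (Y *\<^sub>T s)"
  proof -
    have "At\<^sup>\<top> = A\<^sup>\<top> +\<^sub>T X *\<^sub>T R\<^sup>\<top>"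
      unfolding At_eq by (simp only: t_transpose_add[OF p A RX] t_transpose_prod[OF p R XT] t_transpose_transpose[OF p X])
    then have "\<mu> \<cdot>\<^sub>T Y = A\<^sup>\<top> *\<^sub>T R +\<^sub>T X *\<^sub>T G"
      unfolding stat[symmetric] G_def
      by (simp only: t_prod_add_left[OF p AT c[OF X RT] R] t_prod_assoc[OF p X RT R])
    then have "\<mu> \<cdot>\<^sub>T (Y *\<^sub>T s) = (A\<^sup>\<top> *\<^sub>T R +\<^sub>T X *\<^sub>T G) *\<^sub>T s"
      by (simp only: t_prod_smult_left[OF p Y s, symmetric])
    then show ?thesis
      by (simp only: t_prod_add_left[OF p AtTR XG s] t_prod_assoc[OF p AT R s] t_prod_assoc[OF p X G s] Rs)
  qed
  have eq1: "(A\<^sup>\<top> *\<^sub>T A +\<^sub>T lI \<otimes>\<^sub>T t_id n p +\<^sub>T K\<^sup>\<top> *\<^sub>T K *\<^sub>T (lK \<otimes>\<^sub>T t_id n p)) *\<^sub>T X = A\<^sup>\<top> *\<^sub>T B"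
  proof -
    note DI = tube_diag_carrier[OF p, of n lI] and DK = tube_diag_carrier[OF p, of n lK] and KK = c[OF KT K]
    note KKD = c[OF KK DK] and S1 = t_add_carrier[OF p AA DI]
    note c3 = t_smult_carrier[OF p XGs, of "- 1"]
    have 1: "tube_diag p n lI *\<^sub>T X = (- 1) \<cdot>\<^sub>T (X *\<^sub>T (G *\<^sub>T s))"
      unfolding tube_diag_prod[OF p lI X] unfolding lI_eq by (rule t_prod_smult_right[OF p X Gs])
    \<comment> \<open>Once the tube \<open>lK\<close> stands to the right of \<open>X\<close>, the
      remaining factors form \<open>Y\<close>, and \<open>adj\<close> can be applied.\<close>
    have 2: "K\<^sup>\<top> *\<^sub>T K *\<^sub>T tube_diag p n lK *\<^sub>T X = \<mu> \<cdot>\<^sub>T (Y *\<^sub>T s)"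
      unfolding t_prod_assoc[OF p KK DK X] tube_diag_prod[OF p lK X] t_prod_assoc[OF p KK X lK, symmetric]
        t_prod_assoc[OF p KT K X] Y_def[symmetric]
      unfolding lK_eq by (rule t_prod_smult_right[OF p Y s])
    have "(A\<^sup>\<top> *\<^sub>T A +\<^sub>T lI \<otimes>\<^sub>T t_id n p +\<^sub>T K\<^sup>\<top> *\<^sub>T K *\<^sub>T (lK \<otimes>\<^sub>T t_id n p)) *\<^sub>T X =
        A\<^sup>\<top> *\<^sub>T (A *\<^sub>T X) +\<^sub>T (- 1) \<cdot>\<^sub>T (X *\<^sub>T (G *\<^sub>T s)) +\<^sub>T
        (A\<^sup>\<top> *\<^sub>T (B -\<^sub>T A *\<^sub>T X) +\<^sub>T X *\<^sub>T (G *\<^sub>T s))"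
      unfolding t_kron_id[OF p lI] t_kron_id[OF p lK] t_prod_add_left[OF p S1 KKD X]
        t_prod_add_left[OF p AA DI X] 1 2 adj t_prod_assoc[OF p AT A X] ..
    \<comment> \<open>The \<open>lI\<close> term is the negative of the correction
      \<open>X * G * s\<close> in \<open>adj\<close>, and the two occurrences of
      \<open>A^T * A * X\<close> cancel as well.\<close>
    also have "\<dots> = A\<^sup>\<top> *\<^sub>T B"
      unfolding t_prod_minus_right[OF p AT B AX]
    proof (rule tensor_eqI[OF p _ AB])
      note c4 = t_add_carrier[OF p AAX c3] and c5 = t_minus_carrier[OF p AB AAX]
      note c6 = t_add_carrier[OF p c5 XGs]
      show "A\<^sup>\<top> *\<^sub>T (A *\<^sub>T X) +\<^sub>T (- 1) \<cdot>\<^sub>T (X *\<^sub>T (G *\<^sub>T s)) +\<^sub>T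
        (A\<^sup>\<top> *\<^sub>T B -\<^sub>T A\<^sup>\<top> *\<^sub>T (A *\<^sub>T X) +\<^sub>T X *\<^sub>T (G *\<^sub>T s)) \<in> tensor_carrier n 1 p"
        by (rule t_add_carrier[OF p c4 c6])
      fix k and i j :: nat assume "i < n" "j < 1"
      then show "t_entry (A\<^sup>\<top> *\<^sub>T (A *\<^sub>T X) +\<^sub>T (- 1) \<cdot>\<^sub>T (X *\<^sub>T (G *\<^sub>T s)) +\<^sub>T
        (A\<^sup>\<top> *\<^sub>T B -\<^sub>T A\<^sup>\<top> *\<^sub>T (A *\<^sub>T X) +\<^sub>T X *\<^sub>T (G *\<^sub>T s))) k i j = t_entry (A\<^sup>\<top> *\<^sub>T B) k i j"
        by (simp add: t_entry_add[OF p c4 c6] t_entry_add[OF p AAX c3] t_entry_add[OF p c5 XGs]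
            t_entry_minus[OF p AB AAX] t_entry_smult[OF p XGs])
    qed
    finally show ?thesis .
  qed
  have eq5: "lK *\<^sub>T X\<^sup>\<top> *\<^sub>T K\<^sup>\<top> *\<^sub>T K *\<^sub>T X = B\<^sup>\<top> *\<^sub>T (B -\<^sub>T A *\<^sub>T X) +\<^sub>T lI"
  proof -
    have "lK *\<^sub>T X\<^sup>\<top> *\<^sub>T K\<^sup>\<top> *\<^sub>T K *\<^sub>T X = lK *\<^sub>T P"
      unfolding P_def Y_def
      by (simp only: t_prod_assoc[OF p c[OF c[OF lK XT] KT] K X] t_prod_assoc[OF p c[OF lK XT] KT KX]
          t_prod_assoc[OF p lK XT c[OF KT KX]])
    \<comment> \<open>Tubes commute, so \<open>s\<close> moves to the right of \<open>P\<close>: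
      there it can absorb \<open>R\<close> through \<open>Rs\<close> once mu P is expanded.\<close>
    also have "\<dots> = (\<mu> \<cdot>\<^sub>T P) *\<^sub>T s"
      unfolding lK_eq by (simp only: t_prod_smult_left[OF p s P] t_prod_smult_left[OF p P s] tube_prod_commute[OF p s P])
    also have "\<dots> = B\<^sup>\<top> *\<^sub>T (B -\<^sub>T A *\<^sub>T X) -\<^sub>T G *\<^sub>T s"
      unfolding muP_eq by (simp only: t_prod_minus_left[OF p BR G s] t_prod_assoc[OF p BT R s] Rs)
    also have "\<dots> = B\<^sup>\<top> *\<^sub>T (B -\<^sub>T A *\<^sub>T X) +\<^sub>T lI"
      by (rule tensor_eqI[OF p t_minus_carrier[OF p BBAX Gs] t_add_carrier[OF p BBAX lI]])
        (simp add: t_entry_minus[OF p BBAX Gs] t_entry_add[OF p BBAX lI] lI_entry)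
    finally show ?thesis .
  qed
  show ?thesis
    using eq1 muP_eq inv R_eq eq5 unfolding XKKX s_def G_def by simp
qed

end
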